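(* Let $1\le d\le k$ be integers and let $p=n^{\alpha}$ with $\alpha<\frac{-1}{k-d+1}$. Then asymptotically almost surely $\tilde H_k(\Delta_d(G_d(n,p));\mathbb{Z})=0$.
   Context: $G_d(n,p)$ is the random $d$-dimensional simplicial complex on $[n]$ containing the full $(d-1)$-skeleton, each $(d+1)$-subset of $[n]$ being a $d$-face independently with probability $p$. For a simplicial complex $X$ on vertex set $V$, the $d$-clique complex $\Delta_d(X)$ is the simplicial complex on $V$ whose faces are all $F\subseteq V$ all of whose $(d+1)$-subsets are faces of $X$. $\tilde H$ denotes reduced homology. "Asymptotically almost surely" means with probability tending to $1$ as $n\to\infty$. *)

theory Defs
  imports "HOL-Probability.Probability" "HOL-Algebra.Elementary_Groups" "HOL-Algebra.Free_Abelian_Groups"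
begin

section \<open>Abstract simplicial complexes\<close>

text \<open>A complex is given by its set of faces, the empty face included; a face \<open>\<sigma>\<close> has dimension
  \<open>card \<sigma> - 1\<close>.\<close>

definition abstract_simplicial_complex :: "'a set \<Rightarrow> 'a set set \<Rightarrow> bool" where
  "abstract_simplicial_complex V X \<longleftrightarrow>
     (\<forall>\<sigma>\<in>X. finite \<sigma> \<and> \<sigma> \<subseteq> V) \<and> (\<forall>v\<in>V. {v} \<in> X) \<and> (\<forall>\<sigma>\<in>X. \<forall>\<tau>. \<tau> \<subseteq> \<sigma> \<longrightarrow> \<tau> \<in> X)"

definition clique_complex :: "nat \<Rightarrow> 'a set \<Rightarrow> 'a set set \<Rightarrow> 'a set set" where
  "clique_complex d V X = {F. F \<subseteq> V \<and> (\<forall>\<sigma>. \<sigma> \<subseteq> F \<and> card \<sigma> = d + 1 \<longrightarrow> \<sigma> \<in> X)}"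

section \<open>Reduced simplicial homology with integer coefficients\<close>

text \<open>The vertices are linearly ordered, and every face carries the orientation given by its
  increasing enumeration. The chain complex is augmented: degree \<open>-1\<close> is generated by the empty
  face, and the boundary of a vertex is the empty face.\<close>

definition simplicial_chain_group :: "'a set set \<Rightarrow> int \<Rightarrow> ('a set \<Rightarrow>\<^sub>0 int) monoid" where
  "simplicial_chain_group X q = free_Abelian_group {\<sigma> \<in> X. finite \<sigma> \<and> int (card \<sigma>) = q + 1}"

text \<open>The exponent \<open>card {u \<in> \<sigma>. u < v}\<close> is the position of the vertex \<open>v\<close> in the increasing
  enumeration \<open>v\<^sub>0 < \<dots> < v\<^sub>q\<close> of \<open>\<sigma>\<close>.\<close>

definition simplicial_boundary :: "('a::linorder set \<Rightarrow>\<^sub>0 int) \<Rightarrow> ('a set \<Rightarrow>\<^sub>0 int)" where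
  "simplicial_boundary =
     frag_extend (\<lambda>\<sigma>. \<Sum>v\<in>\<sigma>. frag_cmul ((- 1) ^ card {u \<in> \<sigma>. u < v}) (frag_of (\<sigma> - {v})))"

definition simplicial_cycles :: "'a::linorder set set \<Rightarrow> int \<Rightarrow> ('a set \<Rightarrow>\<^sub>0 int) set" where
  "simplicial_cycles X q =
     kernel (simplicial_chain_group X q) (simplicial_chain_group X (q - 1)) simplicial_boundary"

definition simplicial_boundaries :: "'a::linorder set set \<Rightarrow> int \<Rightarrow> ('a set \<Rightarrow>\<^sub>0 int) set" where
  "simplicial_boundaries X q = simplicial_boundary ` carrier (simplicial_chain_group X (q + 1))"

definition reduced_simplicial_homology ::
    "'a::linorder set set \<Rightarrow> int \<Rightarrow> ('a set \<Rightarrow>\<^sub>0 int) set monoid" where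
  "reduced_simplicial_homology X q =
     (simplicial_chain_group X q)\<lparr>carrier := simplicial_cycles X q\<rparr> Mod simplicial_boundaries X q"

section \<open>The random complex\<close>

text \<open>The full \<open>(d - 1)\<close>-skeleton on \<open>{1..n}\<close> consists of the subsets with at most \<open>d\<close> elements.\<close>

definition random_complex :: "nat \<Rightarrow> nat \<Rightarrow> real \<Rightarrow> nat set set pmf" where
  "random_complex d n p =
     map_pmf (\<lambda>\<omega>. {\<sigma>. \<sigma> \<subseteq> {1..n} \<and> card \<sigma> \<le> d} \<union>
                  {\<sigma>. \<sigma> \<subseteq> {1..n} \<and> card \<sigma> = d + 1 \<and> \<omega> \<sigma>})
       (Pi_pmf {\<sigma>. \<sigma> \<subseteq> {1..n} \<and> card \<sigma> = d + 1} False (\<lambda>_. bernoulli_pmf p))"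

section \<open>Well-definedness\<close>

lemma random_complex_is_complex:
  assumes "1 \<le> d" "X \<in> set_pmf (random_complex d n p)"
  shows "abstract_simplicial_complex {1..n} X"
proof -
  obtain w where X: "X = {\<sigma>. \<sigma> \<subseteq> {1..n} \<and> card \<sigma> \<le> d} \<union> {\<sigma>. \<sigma> \<subseteq> {1..n} \<and> card \<sigma> = d + 1 \<and> w \<sigma>}"
    using assms(2) unfolding random_complex_def set_map_pmf by blast
  have "\<tau> \<in> X" if "\<sigma> \<in> X" "\<tau> \<subseteq> \<sigma>" for \<sigma> \<tau>
  proof (cases "\<tau> = \<sigma>")
    case False
    have "\<sigma> \<subseteq> {1..n}" "card \<sigma> \<le> d + 1" using that(1) X by auto
    then have "finite \<sigma>" by (meson finite_atLeastAtMost finite_subset)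
    then have "card \<tau> < card \<sigma>" using False that(2) by (meson psubsetI psubset_card_mono)
    then have "card \<tau> \<le> d" using \<open>card \<sigma> \<le> d + 1\<close> by simp
    then show ?thesis using X that(2) \<open>\<sigma> \<subseteq> {1..n}\<close> by blast
  qed (use that in simp)
  moreover have "finite \<sigma> \<and> \<sigma> \<subseteq> {1..n}" if "\<sigma> \<in> X" for \<sigma>
    using that X finite_subset[of \<sigma> "{1..n}"] by blast
  moreover have "{v} \<in> X" if "v \<in> {1..n}" for v
    using that X assms(1) by simp
  ultimately show ?thesis unfolding abstract_simplicial_complex_def by blast
qed

lemma clique_complex_is_complex:
  assumes "1 \<le> d" "finite V"
  shows "abstract_simplicial_complex V (clique_complex d V X)"
proof -
  have "{v} \<in> clique_complex d V X" if v: "v \<in> V" for v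
  proof -
    have "\<sigma> \<notin> Pow {v}" if "card \<sigma> = d + 1" for \<sigma>
      using that assms(1) card_mono[of "{v}" \<sigma>] by auto
    then show ?thesis using v unfolding clique_complex_def by blast
  qed
  moreover have "finite \<sigma> \<and> \<sigma> \<subseteq> V" if "\<sigma> \<in> clique_complex d V X" for \<sigma>
    using that assms(2) finite_subset unfolding clique_complex_def by blast
  moreover have "\<tau> \<in> clique_complex d V X" if "\<sigma> \<in> clique_complex d V X" "\<tau> \<subseteq> \<sigma>" for \<sigma> \<tau>
    using that unfolding clique_complex_def by blast
  ultimately show ?thesis unfolding abstract_simplicial_complex_def by blast
qed

lemma simplicial_boundary_add:
  "simplicial_boundary (a + b) = simplicial_boundary a + simplicial_boundary b"
  by (simp add: simplicial_boundary_def frag_extend_add)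

lemma simplicial_boundary_of:
  "simplicial_boundary (frag_of \<sigma>) =
     (\<Sum>v\<in>\<sigma>. frag_cmul ((- 1) ^ card {u \<in> \<sigma>. u < v}) (frag_of (\<sigma> - {v})))"
  by (simp add: simplicial_boundary_def)

lemma simplicial_boundary_boundary_of:
  fixes \<sigma> :: "'a::linorder set"
  assumes fin: "finite \<sigma>"
  shows "simplicial_boundary (simplicial_boundary (frag_of \<sigma>)) = 0"
proof -
  define s where "s \<tau> v = (- 1 :: int) ^ card {u \<in> \<tau>. u < v}" for \<tau> :: "'a set" and v
  define g where "g v w = frag_cmul (s \<sigma> v * s (\<sigma> - {v}) w) (frag_of (\<sigma> - {v} - {w}))" for v w
  have bd: "simplicial_boundary (frag_of \<tau>) = (\<Sum>v\<in>\<tau>. frag_cmul (s \<tau> v) (frag_of (\<tau> - {v})))"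
    for \<tau> :: "'a set"
    by (simp add: simplicial_boundary_of s_def)
  have "simplicial_boundary (simplicial_boundary (frag_of \<sigma>)) =
      (\<Sum>v\<in>\<sigma>. frag_cmul (s \<sigma> v) (simplicial_boundary (frag_of (\<sigma> - {v}))))"
    using fin by (subst bd[of \<sigma>])
      (simp add: simplicial_boundary_def frag_extend_sum frag_extend_cmul o_def)
  also have "\<dots> = (\<Sum>v\<in>\<sigma>. \<Sum>w\<in>\<sigma> - {v}. g v w)"
    by (simp add: bd g_def frag_cmul_sum)
  also have "\<dots> = (\<Sum>v\<in>\<sigma>. \<Sum>w\<in>\<sigma>. if w = v then 0 else g v w)"
    by (intro sum.cong refl sum.mono_neutral_cong_left) (use fin in auto)
  finally have 1: "simplicial_boundary (simplicial_boundary (frag_of \<sigma>)) =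
      (\<Sum>v\<in>\<sigma>. \<Sum>w\<in>\<sigma>. if w = v then 0 else g v w)" (is "?b = ?S") .
  have sgn: "s \<sigma> v * s (\<sigma> - {v}) w = - (s \<sigma> w * s (\<sigma> - {w}) v)"
    if "v \<in> \<sigma>" "w \<in> \<sigma>" "v < w" for v w
  proof -
    have "{u \<in> \<sigma>. u < w} = insert v {u \<in> \<sigma> - {v}. u < w}" using that by auto
    then have "card {u \<in> \<sigma>. u < w} = Suc (card {u \<in> \<sigma> - {v}. u < w})" using fin by simp
    moreover have "{u \<in> \<sigma> - {w}. u < v} = {u \<in> \<sigma>. u < v}" using that by auto
    ultimately show ?thesis by (simp add: s_def)
  qed
  have anti: "g v w = - g w v" if "v \<in> \<sigma>" "w \<in> \<sigma>" "v \<noteq> w" for v w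
  proof -
    have c: "s \<sigma> v * s (\<sigma> - {v}) w = - (s \<sigma> w * s (\<sigma> - {w}) v)"
      using sgn[of v w] sgn[of w v] that by (cases v w rule: linorder_cases) auto
    have "\<sigma> - {v} - {w} = \<sigma> - {w} - {v}" by blast
    then show ?thesis unfolding g_def c by simp
  qed
  have "?S = (\<Sum>w\<in>\<sigma>. \<Sum>v\<in>\<sigma>. if w = v then 0 else g v w)"
    by (rule sum.swap)
  also have "\<dots> = (\<Sum>w\<in>\<sigma>. \<Sum>v\<in>\<sigma>. - (if v = w then 0 else g w v))"
  proof (intro sum.cong refl)
    fix w v assume "w \<in> \<sigma>" "v \<in> \<sigma>"
    then show "(if w = v then 0 else g v w) = - (if v = w then 0 else g w v)"
      using anti[of v w] by (cases "v = w") auto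
  qed
  also have "\<dots> = - ?S" by (simp add: sum_negf)
  finally have "?S = - ?S" .
  then have "?S + ?S = 0" by (simp only: eq_neg_iff_add_eq_0)
  moreover have "frag_cmul 2 ?S = ?S + ?S"
    using frag_cmul_distrib[of 1 1 ?S] by simp
  ultimately have "frag_cmul 2 ?S = 0" by (simp only:)
  then have "?S = 0" by (simp only: frag_cmul_eq_0_iff) simp
  then show ?thesis using 1 by simp
qed

lemma simplicial_boundary_boundary:
  assumes "c \<in> carrier (simplicial_chain_group X q)"
  shows "simplicial_boundary (simplicial_boundary c) = 0"
proof -
  have "Poly_Mapping.keys c \<subseteq> {\<sigma>. finite \<sigma>}"
    using assms by (auto simp: simplicial_chain_group_def free_Abelian_group_def)
  then show ?thesis
  proof (induction c rule: frag_induction)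
    case zero
    show ?case by (simp add: simplicial_boundary_def)
  next
    case (one \<sigma>)
    then show ?case by (simp add: simplicial_boundary_boundary_of)
  next
    case (diff a b)
    then show ?case by (simp add: simplicial_boundary_def frag_extend_diff)
  qed
qed

lemma simplicial_boundary_in_chain_group:
  assumes X: "abstract_simplicial_complex V X" and c: "c \<in> carrier (simplicial_chain_group X q)"
  shows "simplicial_boundary c \<in> carrier (simplicial_chain_group X (q - 1))"
proof -
  have "Poly_Mapping.keys c \<subseteq> {\<sigma> \<in> X. finite \<sigma> \<and> int (card \<sigma>) = q + 1}"
    using c by (simp add: simplicial_chain_group_def free_Abelian_group_def)
  then show ?thesis
  proof (induction c rule: frag_induction)
    case zero
    show ?case by (simp add: simplicial_boundary_def simplicial_chain_group_def free_Abelian_group_def)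
  next
    case (one \<sigma>)
    have "\<sigma> - {v} \<in> {\<sigma> \<in> X. finite \<sigma> \<and> int (card \<sigma>) = q - 1 + 1}" if "v \<in> \<sigma>" for v
    proof -
      have "\<sigma> - {v} \<in> X"
        using X one by (auto simp: abstract_simplicial_complex_def)
      moreover have "int (card (\<sigma> - {v})) = q"
        using one that card_Suc_Diff1[of \<sigma> v] by simp
      ultimately show ?thesis using one by simp
    qed
    then have "frag_cmul k (frag_of (\<sigma> - {v})) \<in> carrier (simplicial_chain_group X (q - 1))"
      if "v \<in> \<sigma>" for k v
      using that keys_cmul[of k "frag_of (\<sigma> - {v})"]
      by (auto simp: simplicial_chain_group_def free_Abelian_group_def)
    then have "Poly_Mapping.keys (simplicial_boundary (frag_of \<sigma>))
        \<subseteq> {\<sigma> \<in> X. finite \<sigma> \<and> int (card \<sigma>) = q - 1 + 1}"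
      unfolding simplicial_boundary_of
      by (intro order_trans[OF keys_sum] UN_least)
        (simp add: simplicial_chain_group_def free_Abelian_group_def)
    then show ?case by (simp add: simplicial_chain_group_def free_Abelian_group_def)
  next
    case (diff a b)
    then show ?case
      using keys_diff[of "simplicial_boundary a" "simplicial_boundary b"]
      by (auto simp: simplicial_boundary_def frag_extend_diff
          simplicial_chain_group_def free_Abelian_group_def)
  qed
qed

lemma group_reduced_simplicial_homology:
  assumes X: "abstract_simplicial_complex V X"
  shows "group (reduced_simplicial_homology X q)"
proof -
  let ?C = "simplicial_chain_group X"
  let ?Z = "(?C q)\<lparr>carrier := simplicial_cycles X q\<rparr>"
  have comm: "comm_group (?C r)" for r
    by (simp add: simplicial_chain_group_def abelian_free_Abelian_group)
  have bd: "group_hom (?C r) (?C (r - 1)) simplicial_boundary" for r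
    using simplicial_boundary_in_chain_group[OF X] comm
    by (auto simp: group_hom_def group_hom_axioms_def hom_def comm_group_def
        simplicial_chain_group_def simplicial_boundary_add)
  have Z: "subgroup (simplicial_cycles X q) (?C q)"
    unfolding simplicial_cycles_def by (rule group_hom.subgroup_kernel[OF bd])
  have "subgroup (simplicial_boundaries X q) (?C q)"
    using group_hom.img_is_subgroup[OF bd[of "q + 1"]] by (simp add: simplicial_boundaries_def)
  moreover have "simplicial_boundaries X q \<subseteq> simplicial_cycles X q"
    using simplicial_boundary_in_chain_group[OF X, of _ "q + 1"] simplicial_boundary_boundary[of _ X "q + 1"]
    by (auto simp: simplicial_boundaries_def simplicial_cycles_def kernel_def
        simplicial_chain_group_def free_Abelian_group_def)
  ultimately have B: "subgroup (simplicial_boundaries X q) ?Z"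
    using Z comm by (simp add: comm_group_def group.subgroup_incl)
  have "comm_group ?Z"
  proof (rule group.group_comm_groupI)
    show "group ?Z"
      using comm[of q] Z by (simp add: comm_group_def group.subgroup_imp_group)
  qed (simp add: simplicial_chain_group_def free_Abelian_group_def add.commute)
  then have "simplicial_boundaries X q \<lhd> ?Z"
    using B comm_group.normal_iff_subgroup by blast
  then show ?thesis
    unfolding reduced_simplicial_homology_def by (rule normal.factorgroup_is_group)
qed

end

theory Submission
  imports Defs
begin

text \<open>Put \<open>j = k - d + 1\<close>, so that \<open>1 + \<alpha> j < 0\<close>, and let \<open>e(T)\<close> be the number of \<open>d\<close>-faces inside a
  vertex set \<open>T\<close>. A first moment computation excludes, for a fixed large \<open>M\<close>, all vertex sets \<open>T\<close> with
  \<open>|T| \<le> M\<close> and \<open>e(T) \<ge> j |T|\<close>, and all \<open>T\<close> with \<open>|T| = M\<close> and \<open>e(T) \<ge> j (M - k - 1)\<close>. The rest is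
  deterministic.

  Grow a vertex set from a face of a \<open>k\<close>-cycle by adjoining vertices of cliques that share \<open>k\<close>
  vertices with it: each step contributes at least \<open>binomial k d \<ge> j\<close> new \<open>d\<close>-faces, so growth stops
  below \<open>M\<close> vertices and splits off a cycle supported on few vertices. In a small vertex set some
  vertex lies in fewer than \<open>(d + 1) j\<close> faces of dimension \<open>d\<close>. Its link then has no
  \<open>(k - 1)\<close>-homology: for \<open>d \<ge> 2\<close> there are too few faces for a nonzero cycle, which needs
  \<open>binomial (k + 1) d\<close> of them, and for \<open>d = 1\<close> the link is a flag complex on fewer than \<open>2 k\<close> vertices.
  So the cycle can be pushed off that vertex, and one concludes by induction.\<close>

section \<open>Cones and links\<close>

text \<open>For v in \<sigma> this is the coefficient of \<open>\<sigma> - {v}\<close> in the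
  boundary of \<sigma>. It is also used for v outside \<sigma>, where the exponent is the position
  that v takes in \<open>insert v \<sigma>\<close>.\<close>

definition vertex_sign :: "'a::linorder set \<Rightarrow> 'a \<Rightarrow> int" where
  "vertex_sign \<sigma> v = (- 1) ^ card {u \<in> \<sigma>. u < v}"

text \<open>The sign makes \<sigma> appear with coefficient 1 in the boundary of its cone. This is a
  geometric cone only on chains whose faces avoid v.\<close>

definition cone_chain :: "'a::linorder \<Rightarrow> ('a set \<Rightarrow>\<^sub>0 int) \<Rightarrow> ('a set \<Rightarrow>\<^sub>0 int)" where
  "cone_chain v = frag_extend (\<lambda>\<sigma>. frag_cmul (vertex_sign \<sigma> v) (frag_of (insert v \<sigma>)))"

lemma boundary_frag_of:
  "simplicial_boundary (frag_of \<sigma>) = (\<Sum>v\<in>\<sigma>. frag_cmul (vertex_sign \<sigma> v) (frag_of (\<sigma> - {v})))"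
  by (simp add: simplicial_boundary_of vertex_sign_def)

lemma boundary_zero [simp]: "simplicial_boundary 0 = 0"
  and boundary_diff: "simplicial_boundary (a - b) = simplicial_boundary a - simplicial_boundary b"
  and boundary_cmul: "simplicial_boundary (frag_cmul k a) = frag_cmul k (simplicial_boundary a)"
  by (simp_all add: simplicial_boundary_def frag_extend_diff frag_extend_cmul)

lemma cone_zero [simp]: "cone_chain v 0 = 0"
  and cone_add: "cone_chain v (a + b) = cone_chain v a + cone_chain v b"
  and cone_diff: "cone_chain v (a - b) = cone_chain v a - cone_chain v b"
  and cone_minus: "cone_chain v (- a) = - cone_chain v a"
  and cone_cmul: "cone_chain v (frag_cmul k a) = frag_cmul k (cone_chain v a)"
  and cone_frag_of: "cone_chain v (frag_of \<sigma>) = frag_cmul (vertex_sign \<sigma> v) (frag_of (insert v \<sigma>))"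
  by (simp_all add: cone_chain_def frag_extend_add frag_extend_diff frag_extend_minus frag_extend_cmul)

lemma cone_sum: "finite I \<Longrightarrow> cone_chain v (\<Sum>i\<in>I. g i) = (\<Sum>i\<in>I. cone_chain v (g i))"
  by (induction I rule: finite_induct) (auto simp: cone_add)

lemma keys_boundary:
  "Poly_Mapping.keys (simplicial_boundary c) \<subseteq> {\<sigma> - {v} | \<sigma> v. \<sigma> \<in> Poly_Mapping.keys c \<and> v \<in> \<sigma>}"
proof -
  have of: "Poly_Mapping.keys (simplicial_boundary (frag_of \<sigma>)) \<subseteq> (\<lambda>v. \<sigma> - {v}) ` \<sigma>" for \<sigma> :: "'a set"
    unfolding boundary_frag_of
    by (rule order_trans[OF keys_sum UN_least]) (simp add: keys_frag_of subset_iff)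
  have "Poly_Mapping.keys (simplicial_boundary c)
      \<subseteq> (\<Union>\<sigma>\<in>Poly_Mapping.keys c. Poly_Mapping.keys (simplicial_boundary (frag_of \<sigma>)))"
    unfolding simplicial_boundary_def frag_extend_of by (rule keys_frag_extend)
  also have "\<dots> \<subseteq> (\<Union>\<sigma>\<in>Poly_Mapping.keys c. (\<lambda>v. \<sigma> - {v}) ` \<sigma>)"
    by (intro UN_mono order_refl of)
  finally show ?thesis by blast
qed

lemma keys_boundary_subset:
  assumes "\<And>\<sigma> u. \<sigma> \<in> Poly_Mapping.keys c \<Longrightarrow> u \<in> \<sigma> \<Longrightarrow> \<sigma> - {u} \<in> S"
  shows "Poly_Mapping.keys (simplicial_boundary c) \<subseteq> S"
  using keys_boundary[of c] assms by blast

lemma keys_cone: "Poly_Mapping.keys (cone_chain v c) \<subseteq> insert v ` Poly_Mapping.keys c"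
proof -
  have "Poly_Mapping.keys (cone_chain v c)
      \<subseteq> (\<Union>\<sigma>\<in>Poly_Mapping.keys c. Poly_Mapping.keys (frag_of (insert v \<sigma>)))"
    unfolding cone_chain_def
    by (rule order_trans[OF keys_frag_extend UN_mono[OF order_refl keys_cmul]])
  then show ?thesis by (auto simp: keys_frag_of)
qed

lemma keys_cone_subset:
  assumes "\<And>\<sigma>. \<sigma> \<in> Poly_Mapping.keys c \<Longrightarrow> insert v \<sigma> \<in> S"
  shows "Poly_Mapping.keys (cone_chain v c) \<subseteq> S"
  using keys_cone[of v c] assms by blast

lemma vertex_sign_square [simp]: "vertex_sign \<sigma> v * vertex_sign \<sigma> v = 1"
  by (simp add: vertex_sign_def)

text \<open>Inserting or deleting the smaller of u and v shifts the position of the larger by one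
  and leaves that of the smaller alone, so the two products differ by exactly one factor -1.\<close>

lemma vertex_sign_cone:
  assumes "finite \<sigma>" "v \<notin> \<sigma>" "u \<in> \<sigma>"
  shows "vertex_sign \<sigma> v * vertex_sign (insert v \<sigma>) u = - (vertex_sign \<sigma> u * vertex_sign (\<sigma> - {u}) v)"
proof (cases "u < v")
  case True
  have "{x \<in> \<sigma>. x < v} = insert u {x \<in> \<sigma> - {u}. x < v}" using assms True by auto
  then have c: "card {x \<in> \<sigma>. x < v} = Suc (card {x \<in> \<sigma> - {u}. x < v})" using assms by simp
  have e: "{x \<in> insert v \<sigma>. x < u} = {x \<in> \<sigma>. x < u}" using True by auto
  show ?thesis unfolding vertex_sign_def c e by simp
next
  case False
  then have "v < u" using assms by (cases u v rule: linorder_cases) auto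
  then have "{x \<in> insert v \<sigma>. x < u} = insert v {x \<in> \<sigma>. x < u}" by auto
  then have c: "card {x \<in> insert v \<sigma>. x < u} = Suc (card {x \<in> \<sigma>. x < u})" using assms by simp
  have e: "{x \<in> \<sigma> - {u}. x < v} = {x \<in> \<sigma>. x < v}" using \<open>v < u\<close> by auto
  show ?thesis unfolding vertex_sign_def c e by simp
qed

text \<open>The facet of the cone opposite v is \<sigma>, with the square of a sign as coefficient;
  the facets through v assemble, by \<open>vertex_sign_cone\<close>, to minus the cone over the
  boundary. Thanks to the augmentation this covers the empty face too.\<close>

lemma boundary_cone:
  assumes "Poly_Mapping.keys c \<subseteq> {\<sigma>. finite \<sigma> \<and> v \<notin> \<sigma>}"
  shows "simplicial_boundary (cone_chain v c) = c - cone_chain v (simplicial_boundary c)"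
  using assms
proof (induction c rule: frag_induction)
  case (one \<sigma>)
  then have fin: "finite \<sigma>" and v: "v \<notin> \<sigma>" by auto
  have sgn: "vertex_sign (insert v \<sigma>) v = vertex_sign \<sigma> v"
    unfolding vertex_sign_def by (rule arg_cong[where f = "\<lambda>A. (- 1) ^ card A"]) auto
  have "simplicial_boundary (cone_chain v (frag_of \<sigma>)) = frag_of \<sigma> +
      (\<Sum>u\<in>\<sigma>. frag_cmul (vertex_sign \<sigma> v * vertex_sign (insert v \<sigma>) u) (frag_of (insert v \<sigma> - {u})))"
    using fin v by (simp add: cone_frag_of boundary_cmul boundary_frag_of frag_cmul_distrib2
        frag_cmul_sum sgn)
  also have "(\<Sum>u\<in>\<sigma>. frag_cmul (vertex_sign \<sigma> v * vertex_sign (insert v \<sigma>) u) (frag_of (insert v \<sigma> - {u})))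
      = (\<Sum>u\<in>\<sigma>. - cone_chain v (frag_cmul (vertex_sign \<sigma> u) (frag_of (\<sigma> - {u}))))"
  proof (rule sum.cong[OF refl])
    fix u assume u: "u \<in> \<sigma>"
    then have "insert v \<sigma> - {u} = insert v (\<sigma> - {u})" using v by auto
    then show "frag_cmul (vertex_sign \<sigma> v * vertex_sign (insert v \<sigma>) u) (frag_of (insert v \<sigma> - {u}))
        = - cone_chain v (frag_cmul (vertex_sign \<sigma> u) (frag_of (\<sigma> - {u})))"
      by (simp add: cone_cmul cone_frag_of vertex_sign_cone[OF fin v u])
  qed
  also have "\<dots> = - cone_chain v (simplicial_boundary (frag_of \<sigma>))"
    using fin by (simp add: boundary_frag_of cone_sum sum_negf)
  finally show ?case by simp
next
  case (diff a b)
  then show ?case by (simp add: boundary_diff cone_diff)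
qed simp

lemma boundary_boundary:
  assumes "Poly_Mapping.keys c \<subseteq> {\<sigma>. finite \<sigma>}"
  shows "simplicial_boundary (simplicial_boundary c) = 0"
  using assms
  by (induction c rule: frag_induction) (simp_all add: simplicial_boundary_boundary_of boundary_diff)

text \<open>Sort the faces of z by whether they contain v: those that do, stripped of v, form
  \<open>a\<close>, a chain of the link; the others form \<open>b\<close>, a chain of the
  deletion.\<close>

lemma cone_decomposition:
  assumes "Poly_Mapping.keys z \<subseteq> S"
  obtains a b where "z = cone_chain v a + b"
    "Poly_Mapping.keys a \<subseteq> {\<sigma>. v \<notin> \<sigma> \<and> insert v \<sigma> \<in> S}"
    "Poly_Mapping.keys b \<subseteq> {\<sigma> \<in> S. v \<notin> \<sigma>}"
proof -
  let ?P = "\<lambda>z. \<exists>a b. z = cone_chain v a + b \<and> Poly_Mapping.keys a \<subseteq> {\<sigma>. v \<notin> \<sigma> \<and> insert v \<sigma> \<in> S}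
    \<and> Poly_Mapping.keys b \<subseteq> {\<sigma> \<in> S. v \<notin> \<sigma>}"
  from assms have "?P z"
  proof (induction z rule: frag_induction)
    case zero
    show ?case by (intro exI[of _ 0]) simp
  next
    case (one \<sigma>)
    show ?case
    proof (cases "v \<in> \<sigma>")
      case True
      \<comment> \<open>The coefficient undoes the sign in \<open>cone_chain\<close>, since signs
        square to 1.\<close>
      then show ?thesis using one
        by (intro exI[of _ "frag_cmul (vertex_sign (\<sigma> - {v}) v) (frag_of (\<sigma> - {v}))"] exI[of _ 0])
          (auto simp: cone_cmul cone_frag_of insert_absorb keys_frag_of)
    next
      case False
      then show ?thesis using one
        by (intro exI[of _ 0] exI[of _ "frag_of \<sigma>"]) (auto simp: keys_frag_of)
    qed
  next
    case (diff x y)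
    then obtain a b a' b' where
      "x = cone_chain v a + b" "Poly_Mapping.keys a \<subseteq> {\<sigma>. v \<notin> \<sigma> \<and> insert v \<sigma> \<in> S}"
      "Poly_Mapping.keys b \<subseteq> {\<sigma> \<in> S. v \<notin> \<sigma>}"
      "y = cone_chain v a' + b'" "Poly_Mapping.keys a' \<subseteq> {\<sigma>. v \<notin> \<sigma> \<and> insert v \<sigma> \<in> S}"
      "Poly_Mapping.keys b' \<subseteq> {\<sigma> \<in> S. v \<notin> \<sigma>}" by blast
    then show ?case using keys_diff[of a a'] keys_diff[of b b']
      by (intro exI[of _ "a - a'"] exI[of _ "b - b'"]) (simp add: cone_diff, blast)
  qed
  then show ?thesis using that by blast
qed

text \<open>The boundary of the chain is \<open>a + simplicial_boundary b\<close> minus the cone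
  over \<open>simplicial_boundary a\<close>. The faces of the former avoid v, those of the latter
  contain v, so both vanish.\<close>

lemma cycle_cone_parts:
  assumes cyc: "simplicial_boundary (cone_chain v a + b) = 0"
    and a: "Poly_Mapping.keys a \<subseteq> {\<sigma>. finite \<sigma> \<and> v \<notin> \<sigma>}"
    and b: "Poly_Mapping.keys b \<subseteq> {\<sigma>. v \<notin> \<sigma>}"
  shows "simplicial_boundary a = 0" "a + simplicial_boundary b = 0"
proof -
  have eq: "a + simplicial_boundary b = cone_chain v (simplicial_boundary a)"
    using cyc boundary_cone[OF a] by (simp add: simplicial_boundary_add algebra_simps)
  have "Poly_Mapping.keys (a + simplicial_boundary b) \<subseteq> {\<sigma>. v \<notin> \<sigma>}"
    by (rule order_trans[OF keys_add Un_least[OF _ keys_boundary_subset]]) (use a b in auto)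
  moreover have "Poly_Mapping.keys (cone_chain v (simplicial_boundary a)) \<subseteq> {\<sigma>. v \<in> \<sigma>}"
    using keys_cone[of v "simplicial_boundary a"] by auto
  ultimately have "Poly_Mapping.keys (a + simplicial_boundary b) = {}"
    unfolding eq by blast
  then show ab: "a + simplicial_boundary b = 0" by simp
  \<comment> \<open>A cycle avoiding v is the boundary of its own cone, so it vanishes as soon as
    the cone does; this is applied to \<open>simplicial_boundary a\<close>.\<close>
  have "Poly_Mapping.keys (simplicial_boundary a) \<subseteq> {\<sigma>. finite \<sigma> \<and> v \<notin> \<sigma>}"
    by (rule keys_boundary_subset) (use a in auto)
  note bc = boundary_cone[OF this]
  have "simplicial_boundary (simplicial_boundary a) = 0"
    by (rule boundary_boundary) (use a in blast)
  moreover have "cone_chain v (simplicial_boundary a) = 0" using eq ab by simp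
  ultimately show "simplicial_boundary a = 0" using bc by simp
qed

text \<open>The second argument is the cardinality of the faces, so \<open>acyclic_at K m\<close> concerns homology in
  dimension \<open>m - 1\<close>.\<close>

definition acyclic_at :: "'a::linorder set set \<Rightarrow> nat \<Rightarrow> bool" where
  "acyclic_at K m \<longleftrightarrow>
     (\<forall>z. Poly_Mapping.keys z \<subseteq> {\<sigma> \<in> K. card \<sigma> = m} \<longrightarrow> simplicial_boundary z = 0 \<longrightarrow>
       (\<exists>c. Poly_Mapping.keys c \<subseteq> {\<sigma> \<in> K. card \<sigma> = Suc m} \<and> simplicial_boundary c = z))"

lemma acyclic_at_no_faces:
  fixes K :: "'a::linorder set set"
  assumes "{\<sigma> \<in> K. card \<sigma> = m} = {}"
  shows "acyclic_at K m"
  unfolding acyclic_at_def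
proof (intro allI impI)
  fix z :: "'a set \<Rightarrow>\<^sub>0 int" assume "Poly_Mapping.keys z \<subseteq> {\<sigma> \<in> K. card \<sigma> = m}"
  then have "z = 0" unfolding assms by simp
  then show "\<exists>c. Poly_Mapping.keys c \<subseteq> {\<sigma> \<in> K. card \<sigma> = Suc m} \<and> simplicial_boundary c = z"
    by (intro exI[of _ 0]) simp
qed

text \<open>Write a cycle as \<open>v * a + b\<close>. Then \<open>a\<close> is a cycle in the link, and if \<open>a\<close> bounds \<open>c\<close> there,
  adding the boundary of \<open>v * c\<close> turns the cycle into \<open>b + c\<close>, which avoids \<open>v\<close>.\<close>

lemma acyclic_at_by_vertex_removal:
  assumes fin: "\<And>\<sigma>. \<sigma> \<in> K \<Longrightarrow> finite \<sigma>" and down: "\<And>\<sigma> \<tau>. \<sigma> \<in> K \<Longrightarrow> \<tau> \<subseteq> \<sigma> \<Longrightarrow> \<tau> \<in> K"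
    and link: "acyclic_at {\<sigma>. v \<notin> \<sigma> \<and> insert v \<sigma> \<in> K} m"
    and del: "acyclic_at {\<sigma> \<in> K. v \<notin> \<sigma>} (Suc m)"
  shows "acyclic_at K (Suc m)"
  unfolding acyclic_at_def
proof (intro allI impI)
  fix z assume z: "Poly_Mapping.keys z \<subseteq> {\<sigma> \<in> K. card \<sigma> = Suc m}" and cyc: "simplicial_boundary z = 0"
  obtain a b where zab: "z = cone_chain v a + b"
    and a: "Poly_Mapping.keys a \<subseteq> {\<sigma>. v \<notin> \<sigma> \<and> insert v \<sigma> \<in> {\<sigma> \<in> K. card \<sigma> = Suc m}}"
    and b: "Poly_Mapping.keys b \<subseteq> {\<sigma> \<in> {\<sigma> \<in> K. card \<sigma> = Suc m}. v \<notin> \<sigma>}"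
    using cone_decomposition[OF z] by blast
  have fin': "finite \<sigma>" if "insert v \<sigma> \<in> K" for \<sigma> using fin[OF that] by simp
  have a1: "Poly_Mapping.keys a \<subseteq> {\<sigma>. finite \<sigma> \<and> v \<notin> \<sigma>}" using a fin' by auto
  have da: "simplicial_boundary a = 0"
    by (rule cycle_cone_parts(1)[of v a b]) (use cyc a1 b in \<open>auto simp: zab\<close>)
  have "card \<sigma> = m" if "v \<notin> \<sigma>" "insert v \<sigma> \<in> K" "card (insert v \<sigma>) = Suc m" for \<sigma>
    using that fin' by simp
  then have "Poly_Mapping.keys a \<subseteq> {\<sigma> \<in> {\<sigma>. v \<notin> \<sigma> \<and> insert v \<sigma> \<in> K}. card \<sigma> = m}" using a by blast
  then obtain c where c: "Poly_Mapping.keys c \<subseteq> {\<sigma> \<in> {\<sigma>. v \<notin> \<sigma> \<and> insert v \<sigma> \<in> K}. card \<sigma> = Suc m}"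
    and dc: "simplicial_boundary c = a"
    using link da unfolding acyclic_at_def by blast
  have "Poly_Mapping.keys c \<subseteq> {\<sigma>. finite \<sigma> \<and> v \<notin> \<sigma>}" using c fin' by auto
  then have dcone: "simplicial_boundary (cone_chain v c) = c - cone_chain v a" using boundary_cone[of c v] dc by simp
  have zbc: "z = (b + c) - simplicial_boundary (cone_chain v c)" unfolding dcone zab by simp
  have "Poly_Mapping.keys c \<subseteq> {\<sigma> \<in> {\<sigma> \<in> K. v \<notin> \<sigma>}. card \<sigma> = Suc m}"
  proof
    fix \<sigma> assume "\<sigma> \<in> Poly_Mapping.keys c"
    then have "v \<notin> \<sigma>" "insert v \<sigma> \<in> K" "card \<sigma> = Suc m" using c by auto
    then show "\<sigma> \<in> {\<sigma> \<in> {\<sigma> \<in> K. v \<notin> \<sigma>}. card \<sigma> = Suc m}"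
      using down[of "insert v \<sigma>" \<sigma>] by auto
  qed
  then have bc: "Poly_Mapping.keys (b + c) \<subseteq> {\<sigma> \<in> {\<sigma> \<in> K. v \<notin> \<sigma>}. card \<sigma> = Suc m}"
    by (intro order_trans[OF keys_add] Un_least) (use b in auto)
  have "Poly_Mapping.keys (cone_chain v c) \<subseteq> {\<sigma>. finite \<sigma>}"
    by (rule keys_cone_subset) (use c fin' in auto)
  then have "simplicial_boundary (simplicial_boundary (cone_chain v c)) = 0"
    by (rule boundary_boundary)
  then have dbc: "simplicial_boundary (b + c) = 0"
    using cyc boundary_diff[of "b + c" "simplicial_boundary (cone_chain v c)"] unfolding zbc by simp
  then obtain e where e: "Poly_Mapping.keys e \<subseteq> {\<sigma> \<in> {\<sigma> \<in> K. v \<notin> \<sigma>}. card \<sigma> = Suc (Suc m)}"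
    and de: "simplicial_boundary e = b + c"
    using del[unfolded acyclic_at_def, rule_format, OF bc dbc] by blast
  have "Poly_Mapping.keys (cone_chain v c) \<subseteq> {\<sigma> \<in> K. card \<sigma> = Suc (Suc m)}"
    by (rule keys_cone_subset) (use c fin' in auto)
  then have "Poly_Mapping.keys (e - cone_chain v c) \<subseteq> {\<sigma> \<in> K. card \<sigma> = Suc (Suc m)}"
    by (intro order_trans[OF keys_diff] Un_least) (use e in auto)
  moreover have "simplicial_boundary (e - cone_chain v c) = z"
    using zbc de by (simp add: boundary_diff)
  ultimately show "\<exists>c. Poly_Mapping.keys c \<subseteq> {\<sigma> \<in> K. card \<sigma> = Suc (Suc m)} \<and> simplicial_boundary c = z"
    by blast
qed

text \<open>Here K is a cone with apex v. For a cycle z = v * a + b the boundary of b is -a, and so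
  v * b has boundary b + v * a = z.\<close>

lemma acyclic_at_cone:
  assumes fin: "\<And>\<sigma>. \<sigma> \<in> K \<Longrightarrow> finite \<sigma>" and cone: "\<And>\<sigma>. \<sigma> \<in> K \<Longrightarrow> insert v \<sigma> \<in> K"
  shows "acyclic_at K m"
  unfolding acyclic_at_def
proof (intro allI impI)
  fix z assume z: "Poly_Mapping.keys z \<subseteq> {\<sigma> \<in> K. card \<sigma> = m}" and cyc: "simplicial_boundary z = 0"
  obtain a b where zab: "z = cone_chain v a + b"
    and a: "Poly_Mapping.keys a \<subseteq> {\<sigma>. v \<notin> \<sigma> \<and> insert v \<sigma> \<in> {\<sigma> \<in> K. card \<sigma> = m}}"
    and b: "Poly_Mapping.keys b \<subseteq> {\<sigma> \<in> {\<sigma> \<in> K. card \<sigma> = m}. v \<notin> \<sigma>}"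
    using cone_decomposition[OF z] by blast
  have "Poly_Mapping.keys a \<subseteq> {\<sigma>. finite \<sigma> \<and> v \<notin> \<sigma>}" using a fin[of "insert v _"] by auto
  then have ab: "a + simplicial_boundary b = 0"
    using cycle_cone_parts(2)[of v a b] cyc b unfolding zab by auto
  have "simplicial_boundary (cone_chain v b) = b - cone_chain v (simplicial_boundary b)"
    by (rule boundary_cone) (use b fin in blast)
  also have "\<dots> = z"
    using ab unfolding zab by (simp add: add_eq_0_iff cone_minus)
  finally have "simplicial_boundary (cone_chain v b) = z" .
  moreover have "Poly_Mapping.keys (cone_chain v b) \<subseteq> {\<sigma> \<in> K. card \<sigma> = Suc m}"
    by (rule keys_cone_subset) (use b fin cone in auto)
  ultimately show "\<exists>c. Poly_Mapping.keys c \<subseteq> {\<sigma> \<in> K. card \<sigma> = Suc m} \<and> simplicial_boundary c = z"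
    by blast
qed

section \<open>Lower bounds on the number of faces of a cycle\<close>

text \<open>The facet \<open>\<sigma> - {u}\<close> has coefficient 1 or -1 in the boundary of
  \<sigma>, so some other face of the cycle must cancel it.\<close>

lemma boundary_face_shared:
  assumes fin: "\<And>\<sigma>. \<sigma> \<in> Poly_Mapping.keys z \<Longrightarrow> finite \<sigma>" and cyc: "simplicial_boundary z = 0"
    and \<sigma>: "\<sigma> \<in> Poly_Mapping.keys z" and u: "u \<in> \<sigma>"
  shows "\<exists>\<tau>\<in>Poly_Mapping.keys z. \<tau> \<noteq> \<sigma> \<and> \<sigma> - {u} \<subseteq> \<tau>"
proof -
  define n where "n = Poly_Mapping.lookup z \<sigma>"
  have n0: "n \<noteq> 0" using \<sigma> by (simp add: n_def in_keys_iff)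
  \<comment> \<open>Removing the term of \<sigma> leaves a chain without \<sigma> whose boundary
    still involves the facet.\<close>
  define z' where "z' = z - frag_cmul n (frag_of \<sigma>)"
  have kz': "Poly_Mapping.keys z' \<subseteq> Poly_Mapping.keys z - {\<sigma>}"
  proof
    fix \<tau> assume "\<tau> \<in> Poly_Mapping.keys z'"
    then have "Poly_Mapping.lookup z \<tau> \<noteq> n * (if \<tau> = \<sigma> then 1 else 0)"
      by (simp add: z'_def in_keys_iff lookup_minus)
    then show "\<tau> \<in> Poly_Mapping.keys z - {\<sigma>}"
      by (auto simp: n_def in_keys_iff split: if_splits)
  qed
  have eq: "\<sigma> - {v} = \<sigma> - {u} \<longleftrightarrow> v = u" if "v \<in> \<sigma>" for v using that u by blast
  have "Poly_Mapping.lookup (simplicial_boundary (frag_of \<sigma>)) (\<sigma> - {u})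
      = (\<Sum>v\<in>\<sigma>. if v = u then vertex_sign \<sigma> v else 0)"
    unfolding boundary_frag_of lookup_sum by (rule sum.cong) (use eq in auto)
  also have "\<dots> = vertex_sign \<sigma> u" using fin[OF \<sigma>] u by simp
  finally have "Poly_Mapping.lookup (simplicial_boundary (frag_of \<sigma>)) (\<sigma> - {u}) \<noteq> 0"
    by (simp add: vertex_sign_def)
  moreover have "simplicial_boundary z' = frag_cmul (- n) (simplicial_boundary (frag_of \<sigma>))"
    using cyc by (simp add: z'_def boundary_diff boundary_cmul)
  ultimately have "\<sigma> - {u} \<in> Poly_Mapping.keys (simplicial_boundary z')"
    using n0 by (simp add: in_keys_iff)
  then have "\<sigma> - {u} \<in> {\<tau> - {w} | \<tau> w. \<tau> \<in> Poly_Mapping.keys z' \<and> w \<in> \<tau>}"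
    by (rule subsetD[OF keys_boundary])
  then obtain \<tau> w where \<tau>: "\<sigma> - {u} = \<tau> - {w}" "\<tau> \<in> Poly_Mapping.keys z'" by auto
  show ?thesis
  proof (rule bexI[of _ \<tau>])
    show "\<tau> \<noteq> \<sigma> \<and> \<sigma> - {u} \<subseteq> \<tau>" using \<tau> kz' by auto
    show "\<tau> \<in> Poly_Mapping.keys z" using \<tau> kz' by auto
  qed
qed

lemma inj_on_insert:
  assumes "\<And>\<rho>. \<rho> \<in> A \<Longrightarrow> v \<notin> \<rho>"
  shows "inj_on (insert v) A"
proof (rule inj_onI)
  fix \<rho> \<rho>' assume "\<rho> \<in> A" "\<rho>' \<in> A" "insert v \<rho> = insert v \<rho>'"
  then show "\<rho> = \<rho>'" using insert_ident[of v \<rho> \<rho>'] assms by simp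
qed

text \<open>Besides the \<open>r\<close>-subsets of one member \<open>\<sigma>\<close>, count those containing a fixed \<open>w \<notin> \<sigma>\<close> by applying
  the induction hypothesis to the link of \<open>w\<close>.\<close>

lemma card_subsets_of_closed_family:
  assumes "finite F" "F \<noteq> {}" and "\<And>\<sigma>. \<sigma> \<in> F \<Longrightarrow> finite \<sigma> \<and> card \<sigma> = m"
    and "\<And>\<sigma> u. \<sigma> \<in> F \<Longrightarrow> u \<in> \<sigma> \<Longrightarrow> \<exists>\<tau>\<in>F. \<tau> \<noteq> \<sigma> \<and> \<sigma> - {u} \<subseteq> \<tau>" and "r \<le> m"
  shows "Suc m choose r \<le> card {\<rho>. card \<rho> = r \<and> (\<exists>\<sigma>\<in>F. \<rho> \<subseteq> \<sigma>)}"
  using assms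
proof (induction m arbitrary: F r)
  have finR: "finite {\<rho>. card \<rho> = r \<and> (\<exists>\<sigma>\<in>F. \<rho> \<subseteq> \<sigma>)}"
    if "finite F" "\<And>\<sigma>. \<sigma> \<in> F \<Longrightarrow> finite \<sigma> \<and> card \<sigma> = m" for F :: "'a set set" and r m
    by (rule finite_subset[of _ "Pow (\<Union>F)"]) (use that in auto)
  {
    case 0
    let ?R = "{\<rho>. card \<rho> = r \<and> (\<exists>\<sigma>\<in>F. \<rho> \<subseteq> \<sigma>)}"
    have "{} \<in> ?R" using 0(2,5) by auto
    moreover have "finite ?R" using 0(1,3) by (rule finR)
    ultimately have "card ?R > 0" using card_gt_0_iff by blast
    then show ?case using 0(5) by simp
  next
    case (Suc m)
    let ?R = "{\<rho>. card \<rho> = r \<and> (\<exists>\<sigma>\<in>F. \<rho> \<subseteq> \<sigma>)}"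
    have fR: "finite ?R" using Suc.prems(1,3) by (rule finR)
    obtain \<sigma> where \<sigma>: "\<sigma> \<in> F" using Suc.prems(2) by blast
    then have c\<sigma>: "finite \<sigma>" "card \<sigma> = Suc m" using Suc.prems(3) by auto
    show ?case
    proof (cases r)
      case 0
      have "{} \<in> ?R" using 0 \<sigma> by auto
      then have "card ?R > 0" using fR card_gt_0_iff by blast
      then show ?thesis using 0 by simp
    next
      case (Suc q)
      obtain u where "u \<in> \<sigma>" using c\<sigma> by fastforce
      then obtain \<tau> where \<tau>: "\<tau> \<in> F" "\<tau> \<noteq> \<sigma>" using Suc.prems(4)[OF \<sigma>] by blast
      then have "\<not> \<tau> \<subseteq> \<sigma>" using Suc.prems(3)[OF \<tau>(1)] c\<sigma> card_subset_eq[of \<sigma> \<tau>] by auto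
      then obtain w where w: "w \<in> \<tau>" "w \<notin> \<sigma>" by blast
      define L where "L = (\<lambda>\<tau>. \<tau> - {w}) ` {\<tau> \<in> F. w \<in> \<tau>}"
      let ?B = "{\<rho>. card \<rho> = q \<and> (\<exists>\<sigma>\<in>L. \<rho> \<subseteq> \<sigma>)}"
      have L1: "finite L" "L \<noteq> {}" using Suc.prems(1) \<tau> w by (auto simp: L_def)
      have L2: "finite \<rho> \<and> card \<rho> = m" if "\<rho> \<in> L" for \<rho>
        using that Suc.prems(3) by (auto simp: L_def)
      \<comment> \<open>The link of w inherits the exchange property: a face that shares
        \<open>\<eta> - {u}\<close> with \<eta>, where u is not w, contains w as well.\<close>
      have L3: "\<exists>\<tau>\<in>L. \<tau> \<noteq> \<rho> \<and> \<rho> - {u} \<subseteq> \<tau>" if \<rho>: "\<rho> \<in> L" "u \<in> \<rho>" for \<rho> u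
      proof -
        obtain \<eta> where \<eta>: "\<eta> \<in> F" "w \<in> \<eta>" "\<rho> = \<eta> - {w}" using \<rho> by (auto simp: L_def)
        then obtain \<theta> where \<theta>: "\<theta> \<in> F" "\<theta> \<noteq> \<eta>" "\<eta> - {u} \<subseteq> \<theta>" using Suc.prems(4)[of \<eta> u] \<rho> by blast
        then have "w \<in> \<theta>" using \<eta> \<rho> by blast
        then show ?thesis using \<theta> \<eta> by (intro bexI[of _ "\<theta> - {w}"]) (auto simp: L_def)
      qed
      have IH: "Suc m choose q \<le> card ?B"
        using Suc.IH[OF L1 L2 L3, of q] Suc.prems(5) Suc by simp
      have wB: "w \<notin> \<rho>" "finite \<rho>" if "\<rho> \<in> ?B" for \<rho>
        using that L2 finite_subset by (auto simp: L_def)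
      have "inj_on (insert w) ?B" using wB(1) by (rule inj_on_insert)
      then have cB: "card (insert w ` ?B) = card ?B" by (rule card_image)
      let ?A = "{\<rho>. \<rho> \<subseteq> \<sigma> \<and> card \<rho> = r}"
      have cA: "card ?A = Suc m choose r" using n_subsets[OF c\<sigma>(1), of r] c\<sigma>(2) by simp
      have sub: "?A \<union> insert w ` ?B \<subseteq> ?R"
      proof -
        have "insert w \<rho> \<in> ?R" if \<rho>: "\<rho> \<in> ?B" for \<rho>
        proof -
          obtain \<eta> where \<eta>: "\<eta> \<in> F" "w \<in> \<eta>" "\<rho> \<subseteq> \<eta> - {w}" using \<rho> unfolding L_def by blast
          then have "insert w \<rho> \<subseteq> \<eta>" by blast
          moreover have "card (insert w \<rho>) = r" using that wB[OF that] Suc by simp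
          ultimately show ?thesis using \<eta>(1) by blast
        qed
        then show ?thesis using \<sigma> by blast
      qed
      \<comment> \<open>Sets in \<open>?A\<close> avoid w and those in the image contain it, so the
        counts add up; Pascal's rule then gives the claimed binomial.\<close>
      have "card (?A \<union> insert w ` ?B) = card ?A + card (insert w ` ?B)"
        using finite_subset[OF sub fR] w(2) by (intro card_Un_disjoint) auto
      then have "card ?A + card ?B \<le> card ?R" using card_mono[OF fR sub] cB by simp
      then show ?thesis using IH cA Suc by simp
    qed
  }
qed

section \<open>Binomial estimates\<close>

lemma binomial_ge_self: "n \<le> n choose r" if "1 \<le> r" "r < n" for n r :: nat
  using that
proof (induction n arbitrary: r)
  case (Suc n)
  obtain q where q: "r = Suc q" using Suc.prems by (cases r) auto
  have "1 \<le> n choose q" using Suc.prems q zero_less_binomial[of q n] by (simp add: Suc_le_eq)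
  moreover have "n \<le> n choose r" if "r < n" using Suc that by simp
  moreover have "n choose q = n" if "r = n" using that q binomial_Suc_n[of q] by simp
  moreover have "r = n \<or> r < n" using Suc.prems by auto
  ultimately show ?case using q by auto
qed simp

text \<open>With i = k - d this bounds from below the number of d-faces that a new vertex brings
  when it is joined to k old vertices.\<close>

lemma binomial_ge_codim:
  assumes "1 \<le> d"
  shows "Suc i \<le> (d + i) choose d"
proof (induction i)
  case (Suc i)
  obtain e where e: "d = Suc e" using assms by (cases d) auto
  have "1 \<le> (d + i) choose e" using e zero_less_binomial[of e "d + i"] by (simp add: Suc_le_eq)
  then show ?case using e Suc.IH by simp
qed simp

text \<open>With i = k - d the left side is the degree threshold for a removable vertex and the
  right side the number of d-subsets forced by a nonzero cycle in its link. For d = 1 the estimate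
  fails from i = 1 on, hence the separate treatment of flag complexes.\<close>

lemma link_face_bound:
  assumes "2 \<le> d"
  shows "(d + 1) * (i + 1) \<le> Suc (d + i) choose d"
proof (induction i)
  case 0
  show ?case using binomial_symmetric[of d "Suc d"] by simp
next
  case (Suc i)
  obtain e where e: "d = Suc e" using assms by (cases d) auto
  have "d + 1 \<le> Suc (d + i) choose e" using binomial_ge_self[of e "Suc (d + i)"] e assms by simp
  then show ?case using Suc e by simp
qed

section \<open>Deletions and links in clique complexes; small flag complexes\<close>

lemma clique_complex_deletion: "{\<sigma> \<in> clique_complex d V X. v \<notin> \<sigma>} = clique_complex d (V - {v}) X"
  by (auto simp: clique_complex_def)

lemma clique_complex_down: "\<sigma> \<in> clique_complex d V X \<Longrightarrow> \<tau> \<subseteq> \<sigma> \<Longrightarrow> \<tau> \<in> clique_complex d V X"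
  by (auto simp: clique_complex_def)

lemma clique_complex_finite: "finite V \<Longrightarrow> \<sigma> \<in> clique_complex d V X \<Longrightarrow> finite \<sigma>"
  by (auto simp: clique_complex_def intro: finite_subset)

text \<open>A pair inside \<open>insert v \<sigma>\<close> either lies in \<sigma> or joins v to a
  vertex of \<sigma>. So links of flag complexes are flag complexes on neighbourhoods, which keeps
  an induction over links within the class.\<close>

lemma flag_complex_link:
  assumes "v \<in> V"
  shows "{\<sigma>. v \<notin> \<sigma> \<and> insert v \<sigma> \<in> clique_complex 1 V X} = clique_complex 1 {w \<in> V - {v}. {v, w} \<in> X} X"
    (is "?L = ?R")
proof (intro equalityI subsetI)
  fix \<sigma> assume "\<sigma> \<in> ?L"
  then have v: "v \<notin> \<sigma>" and sub: "insert v \<sigma> \<subseteq> V"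
    and X: "\<And>\<tau>. \<tau> \<subseteq> insert v \<sigma> \<Longrightarrow> card \<tau> = 2 \<Longrightarrow> \<tau> \<in> X"
    by (auto simp: clique_complex_def)
  have "{v, w} \<in> X" if "w \<in> \<sigma>" for w
  proof (rule X)
    show "card {v, w} = 2" using that v by (cases "v = w") auto
  qed (use that in auto)
  moreover have "\<tau> \<in> X" if "\<tau> \<subseteq> \<sigma>" "card \<tau> = 1 + 1" for \<tau> using X[of \<tau>] that by auto
  ultimately show "\<sigma> \<in> ?R" using v sub unfolding clique_complex_def by blast
next
  fix \<sigma> assume "\<sigma> \<in> ?R"
  then have sub: "\<sigma> \<subseteq> V - {v}" and N: "\<And>w. w \<in> \<sigma> \<Longrightarrow> {v, w} \<in> X"
    and X: "\<And>\<tau>. \<tau> \<subseteq> \<sigma> \<Longrightarrow> card \<tau> = 2 \<Longrightarrow> \<tau> \<in> X"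
    by (auto simp: clique_complex_def)
  have "\<tau> \<in> X" if \<tau>: "\<tau> \<subseteq> insert v \<sigma>" "card \<tau> = 2" for \<tau>
  proof (cases "\<tau> \<subseteq> \<sigma>")
    case False
    obtain x y where "\<tau> = {x, y}" "x \<noteq> y" using \<tau>(2) by (auto simp: card_2_iff)
    then obtain w where "w \<in> \<sigma>" "\<tau> = {v, w}" using \<tau>(1) False by blast
    then show ?thesis using N by simp
  qed (use X \<tau> in blast)
  then show "\<sigma> \<in> ?L" using sub assms unfolding clique_complex_def one_add_one by blast
qed

text \<open>If some vertex is adjacent to all others, the complex is a cone. Otherwise some v misses
  some w; the link of v loses at least two vertices while m drops by one, and the deletion of v has
  fewer vertices. The bound is sharp: the boundary of the cross-polytope has 2 m vertices.\<close>

lemma flag_complex_acyclic_at: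
  fixes V :: "'a::linorder set"
  assumes "finite V" "card V < 2 * m"
  shows "acyclic_at (clique_complex 1 V X) m"
  using assms
proof (induction "card V" arbitrary: V m rule: less_induct)
  case less
  let ?K = "clique_complex 1 V X"
  have "m \<noteq> 0" using less.prems(2) by simp
  then obtain q where q: "m = Suc q" using not0_implies_Suc by blast
  consider "V = {}" | v where "v \<in> V" "\<forall>w\<in>V - {v}. {v, w} \<in> X"
    | v w where "v \<in> V" "w \<in> V - {v}" "{v, w} \<notin> X" by blast
  then show ?case
  proof cases
    case 1
    then have "{\<sigma> \<in> ?K. card \<sigma> = m} = {}" using q by (auto simp: clique_complex_def)
    then show ?thesis by (rule acyclic_at_no_faces)
  next
    case 2
    have "insert v \<sigma> \<in> ?K" if "\<sigma> \<in> ?K" for \<sigma>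
    proof (cases "v \<in> \<sigma>")
      case False
      have "{w \<in> V - {v}. {v, w} \<in> X} = V - {v}" using 2 by blast
      then have "\<sigma> \<in> clique_complex 1 {w \<in> V - {v}. {v, w} \<in> X} X"
        using that False clique_complex_deletion[of 1 V X v] by auto
      then show ?thesis using flag_complex_link[OF 2(1)] by blast
    qed (use that in \<open>simp add: insert_absorb\<close>)
    then show ?thesis
      using acyclic_at_cone[of ?K v m] clique_complex_finite[OF less.prems(1)] by blast
  next
    case 3
    let ?N = "{w \<in> V - {v}. {v, w} \<in> X}"
    have vw: "card {v, w} = 2" using 3(2) by (cases "v = w") simp_all
    have "?N \<subseteq> V - {v, w}" using 3(3) by auto
    then have N: "card ?N \<le> card V - 2" using less.prems(1) 3(1,2) card_mono[of "V - {v, w}" ?N]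
      by (simp add: card_Diff_subset vw)
    have V: "card V > 0" using 3(1) less.prems(1) card_gt_0_iff by blast
    \<comment> \<open>Hence \<open>card V - 2\<close> does not truncate, and together with
      \<open>card V < 2 * m\<close> the case \<open>q = 0\<close> is ruled out.\<close>
    have card_gt: "card V \<ge> 2" using card_mono[of V "{v, w}"] less.prems(1) 3(1,2) vw by simp
    have lk: "acyclic_at (clique_complex 1 ?N X) q"
    proof (rule less.hyps)
      show "card ?N < card V" using N V by simp
      show "finite ?N" using less.prems(1) by simp
      show "card ?N < 2 * q" using N less.prems(2) q card_gt by simp
    qed
    have dl: "acyclic_at (clique_complex 1 (V - {v}) X) (Suc q)"
      by (rule less.hyps) (use less.prems q 3(1) V in simp_all)
    show ?thesis unfolding q
    proof (rule acyclic_at_by_vertex_removal[where v = v])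
      show "acyclic_at {\<sigma>. v \<notin> \<sigma> \<and> insert v \<sigma> \<in> ?K} q"
        unfolding flag_complex_link[OF 3(1)] by (rule lk)
      show "acyclic_at {\<sigma> \<in> ?K. v \<notin> \<sigma>} (Suc q)"
        unfolding clique_complex_deletion by (rule dl)
      show "finite \<sigma>" if "\<sigma> \<in> ?K" for \<sigma>
        using clique_complex_finite[OF less.prems(1) that] .
      show "\<tau> \<in> ?K" if "\<sigma> \<in> ?K" "\<tau> \<subseteq> \<sigma>" for \<sigma> \<tau>
        using clique_complex_down[OF that] .
    qed
  qed
qed

section \<open>Locally sparse complexes\<close>

definition dface_count :: "nat \<Rightarrow> 'a set set \<Rightarrow> 'a set \<Rightarrow> nat" where
  "dface_count d X S = card {\<sigma> \<in> X. \<sigma> \<subseteq> S \<and> card \<sigma> = d + 1}"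

lemma finite_dfaces: "finite S \<Longrightarrow> finite {\<sigma> \<in> X. \<sigma> \<subseteq> S \<and> card \<sigma> = m}"
  by (rule finite_subset[of _ "Pow S"]) auto

text \<open>Adjoining v maps the d-subsets of faces of the link injectively to d-faces through v.
  For d \<ge> 2 the degree bound thus leaves too few d-subsets for a nonzero cycle; for d = 1 it
  bounds the vertices of the link by the threshold 2 k.\<close>

lemma acyclic_link_if_low_degree:
  fixes S :: "'a::linorder set"
  assumes dk: "1 \<le> d" "d \<le> k" and S: "finite S" "v \<in> S"
    and deg: "card {\<sigma> \<in> X. \<sigma> \<subseteq> S \<and> card \<sigma> = d + 1 \<and> v \<in> \<sigma>} < (d + 1) * (k - d + 1)"
  shows "acyclic_at {\<sigma>. v \<notin> \<sigma> \<and> insert v \<sigma> \<in> clique_complex d S X} k"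
proof -
  let ?D = "{\<sigma> \<in> X. \<sigma> \<subseteq> S \<and> card \<sigma> = d + 1 \<and> v \<in> \<sigma>}"
  have finD: "finite ?D" by (rule finite_subset[of _ "Pow S"]) (use S in auto)
  show ?thesis
  proof (cases "d = 1")
    case True
    let ?N = "{w \<in> S - {v}. {v, w} \<in> X}"
    have im: "(\<lambda>w. {v, w}) ` ?N \<subseteq> {\<sigma> \<in> X. \<sigma> \<subseteq> S \<and> card \<sigma> = d + 1 \<and> v \<in> \<sigma>}"
      using True S by auto
    have "inj_on (\<lambda>w. {v, w}) ?N" by (intro inj_onI) blast
    then have "card ?N \<le> card {\<sigma> \<in> X. \<sigma> \<subseteq> S \<and> card \<sigma> = d + 1 \<and> v \<in> \<sigma>}"
      by (rule card_inj_on_le[OF _ im finD])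
    then have "card ?N < 2 * k" using deg True dk by simp
    then have "acyclic_at (clique_complex 1 ?N X) k" using S by (intro flag_complex_acyclic_at) auto
    then show ?thesis using flag_complex_link[OF S(2), of X] True by simp
  next
    case False
    let ?L = "{\<sigma>. v \<notin> \<sigma> \<and> insert v \<sigma> \<in> clique_complex d S X}"
    have zero: "z = 0" if z: "Poly_Mapping.keys z \<subseteq> {\<sigma> \<in> ?L. card \<sigma> = k}" "simplicial_boundary z = 0" for z
    proof (rule ccontr)
      assume "z \<noteq> 0"
      let ?F = "Poly_Mapping.keys z"
      have fin: "finite \<sigma>" if "\<sigma> \<in> ?F" for \<sigma>
        using that z(1) clique_complex_finite[OF S(1), of "insert v \<sigma>"] by auto
      let ?R = "{\<rho>. card \<rho> = d \<and> (\<exists>\<sigma>\<in>?F. \<rho> \<subseteq> \<sigma>)}"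
      have "Suc k choose d \<le> card ?R"
      proof (rule card_subsets_of_closed_family[OF _ _ _ boundary_face_shared[OF fin z(2)] dk(2)])
        show "?F \<noteq> {}" using \<open>z \<noteq> 0\<close> by simp
        show "finite \<sigma> \<and> card \<sigma> = k" if "\<sigma> \<in> ?F" for \<sigma> using fin[OF that] z(1) that by blast
      qed simp_all
      moreover have "card ?R \<le> card ?D"
      proof (rule card_inj_on_le[of "insert v"])
        have R: "v \<notin> \<rho> \<and> insert v \<rho> \<in> clique_complex d S X \<and> card (insert v \<rho>) = d + 1" if \<rho>: "\<rho> \<in> ?R" for \<rho>
        proof -
          obtain \<sigma> where \<sigma>: "\<sigma> \<in> ?F" "\<rho> \<subseteq> \<sigma>" using \<rho> by blast
          then have L: "v \<notin> \<sigma>" "insert v \<sigma> \<in> clique_complex d S X" using z(1) by auto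
          then have "insert v \<rho> \<in> clique_complex d S X"
            using \<sigma>(2) clique_complex_down[of "insert v \<sigma>" d S X "insert v \<rho>"] by blast
          moreover have "finite \<rho>" using \<sigma>(2) fin[OF \<sigma>(1)] by (rule finite_subset)
          moreover have "v \<notin> \<rho>" using \<sigma>(2) L(1) by blast
          ultimately show ?thesis using \<rho> by simp
        qed
        show "inj_on (insert v) ?R" using R by (intro inj_on_insert) blast
        show "insert v ` ?R \<subseteq> ?D"
        proof (rule image_subsetI)
          fix \<rho> assume "\<rho> \<in> ?R"
          from R[OF this] show "insert v \<rho> \<in> ?D" unfolding clique_complex_def by blast
        qed
        show "finite ?D" by (rule finD)
      qed
      moreover have "(d + 1) * (k - d + 1) \<le> Suc k choose d"
        using link_face_bound[of d "k - d"] False dk by simp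
      ultimately show False using deg by linarith
    qed
    show ?thesis unfolding acyclic_at_def
    proof (intro allI impI)
      fix z :: "'a set \<Rightarrow>\<^sub>0 int" assume "Poly_Mapping.keys z \<subseteq> {\<sigma> \<in> ?L. card \<sigma> = k}" "simplicial_boundary z = 0"
      then have "z = 0" by (rule zero)
      then show "\<exists>c. Poly_Mapping.keys c \<subseteq> {\<sigma> \<in> ?L. card \<sigma> = Suc k} \<and> simplicial_boundary c = z"
        by (intro exI[of _ 0]) simp
    qed
  qed
qed

text \<open>Double counting of the incidences between vertices and d-faces.\<close>

lemma sum_degrees:
  assumes "finite S"
  shows "(\<Sum>v\<in>S. card {\<sigma> \<in> X. \<sigma> \<subseteq> S \<and> card \<sigma> = d + 1 \<and> v \<in> \<sigma>}) = (d + 1) * dface_count d X S"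
proof -
  let ?E = "{\<sigma> \<in> X. \<sigma> \<subseteq> S \<and> card \<sigma> = d + 1}"
  have E: "finite ?E" using assms by (rule finite_dfaces)
  have "(\<Sum>v\<in>S. card {\<sigma> \<in> X. \<sigma> \<subseteq> S \<and> card \<sigma> = d + 1 \<and> v \<in> \<sigma>}) = (\<Sum>v\<in>S. \<Sum>\<sigma>\<in>?E. if v \<in> \<sigma> then 1 else 0)"
  proof (rule sum.cong[OF refl])
    fix v
    have "{\<sigma> \<in> X. \<sigma> \<subseteq> S \<and> card \<sigma> = d + 1 \<and> v \<in> \<sigma>} = ?E \<inter> {\<sigma>. v \<in> \<sigma>}" by blast
    then show "card {\<sigma> \<in> X. \<sigma> \<subseteq> S \<and> card \<sigma> = d + 1 \<and> v \<in> \<sigma>} = (\<Sum>\<sigma>\<in>?E. if v \<in> \<sigma> then 1 else 0)"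
      using E by (simp add: sum.If_cases)
  qed
  also have "\<dots> = (\<Sum>\<sigma>\<in>?E. \<Sum>v\<in>S. if v \<in> \<sigma> then 1 else 0)" by (rule sum.swap)
  also have "\<dots> = (\<Sum>\<sigma>\<in>?E. d + 1)"
  proof (rule sum.cong[OF refl])
    fix \<sigma> assume "\<sigma> \<in> ?E"
    then have "S \<inter> {v. v \<in> \<sigma>} = \<sigma>" "card \<sigma> = d + 1" by auto
    then show "(\<Sum>v\<in>S. if v \<in> \<sigma> then 1 else 0) = d + 1" using assms by (simp add: sum.If_cases)
  qed
  finally show ?thesis by (simp add: dface_count_def)
qed

text \<open>The degrees sum to d + 1 times the number of d-faces, so sparsity of S itself yields a
  vertex of low degree, and its link is acyclic. Sparsity is asked of every nonempty subset so that
  it survives deleting this vertex.\<close>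

lemma acyclic_if_sparse:
  fixes S :: "'a::linorder set"
  assumes dk: "1 \<le> d" "d \<le> k" and "finite S"
    and "\<And>T. T \<subseteq> S \<Longrightarrow> T \<noteq> {} \<Longrightarrow> dface_count d X T < (k - d + 1) * card T"
  shows "acyclic_at (clique_complex d S X) (Suc k)"
  using assms(3,4)
proof (induction S rule: finite_psubset_induct)
  case (psubset S)
  show ?case
  proof (cases "S = {}")
    case True
    then have "{\<sigma> \<in> clique_complex d S X. card \<sigma> = Suc k} = {}" by (auto simp: clique_complex_def)
    then show ?thesis by (rule acyclic_at_no_faces)
  next
    case False
    let ?deg = "\<lambda>v. card {\<sigma> \<in> X. \<sigma> \<subseteq> S \<and> card \<sigma> = d + 1 \<and> v \<in> \<sigma>}"
    have "\<exists>v\<in>S. ?deg v < (d + 1) * (k - d + 1)"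
    proof (rule ccontr)
      assume "\<not> ?thesis"
      then have "(\<Sum>v\<in>S. (d + 1) * (k - d + 1)) \<le> (\<Sum>v\<in>S. ?deg v)"
        by (intro sum_mono) (simp add: not_less)
      then have "(d + 1) * ((k - d + 1) * card S) \<le> (d + 1) * dface_count d X S"
        unfolding sum_degrees[OF psubset.hyps(1)] sum_constant of_nat_id by (simp only: mult_ac)
      then have "(k - d + 1) * card S \<le> dface_count d X S" by (simp only: mult_le_cancel1)
      then show False using psubset.prems[of S] False by simp
    qed
    then obtain v where v: "v \<in> S" "?deg v < (d + 1) * (k - d + 1)" by blast
    show ?thesis
    proof (rule acyclic_at_by_vertex_removal[where v = v])
      show "acyclic_at {\<sigma>. v \<notin> \<sigma> \<and> insert v \<sigma> \<in> clique_complex d S X} k"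
        by (rule acyclic_link_if_low_degree[OF dk psubset.hyps(1) v])
      show "acyclic_at {\<sigma> \<in> clique_complex d S X. v \<notin> \<sigma>} (Suc k)"
        unfolding clique_complex_deletion
      proof (rule psubset.IH)
        show "S - {v} \<subset> S" using v(1) by blast
        show "dface_count d X T < (k - d + 1) * card T" if "T \<subseteq> S - {v}" "T \<noteq> {}" for T
          by (rule psubset.prems) (use that in blast)+
      qed
      show "finite \<sigma>" if "\<sigma> \<in> clique_complex d S X" for \<sigma>
        using clique_complex_finite[OF psubset.hyps(1) that] .
      show "\<tau> \<in> clique_complex d S X" if "\<sigma> \<in> clique_complex d S X" "\<tau> \<subseteq> \<sigma>" for \<sigma> \<tau>
        using clique_complex_down[OF that] .
    qed
  qed
qed

text \<open>Each d-subset of \<rho> together with w is a d-face, and it is new because it contains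
  w.\<close>

lemma dface_count_insert:
  assumes "finite T" "w \<notin> T" "\<rho> \<subseteq> T" "card \<rho> = k" "insert w \<rho> \<in> clique_complex d V X" "1 \<le> d" "d \<le> k"
  shows "dface_count d X T + (k - d + 1) \<le> dface_count d X (insert w T)"
proof -
  let ?A = "{\<sigma> \<in> X. \<sigma> \<subseteq> T \<and> card \<sigma> = d + 1}" and ?B = "{\<eta>. \<eta> \<subseteq> \<rho> \<and> card \<eta> = d}"
  let ?C = "{\<sigma> \<in> X. \<sigma> \<subseteq> insert w T \<and> card \<sigma> = d + 1}"
  have \<rho>: "finite \<rho>" using assms finite_subset by blast
  have "inj_on (insert w) ?B" by (rule inj_on_insert) (use assms in blast)
  then have cB: "card (insert w ` ?B) = k choose d"
    using n_subsets[OF \<rho>, of d] assms by (simp add: card_image)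
  have "insert w \<eta> \<in> ?C" if "\<eta> \<in> ?B" for \<eta>
  proof -
    have "card (insert w \<eta>) = d + 1" "insert w \<eta> \<subseteq> insert w \<rho>"
      using that assms finite_subset[of \<eta> \<rho>] \<rho> by (auto simp: card_insert_if)
    then show ?thesis using assms unfolding clique_complex_def by blast
  qed
  then have sub: "?A \<union> insert w ` ?B \<subseteq> ?C" by blast
  have fC: "finite ?C" using assms by (intro finite_dfaces) simp
  have "card ?A + card (insert w ` ?B) = card (?A \<union> insert w ` ?B)"
    using finite_subset[OF sub fC] assms by (intro card_Un_disjoint[symmetric]) auto
  also have "\<dots> \<le> card ?C" by (rule card_mono[OF fC sub])
  finally show ?thesis
    using cB binomial_ge_codim[of d "k - d"] assms by (simp add: dface_count_def)
qed

text \<open>Induction on the number of faces of the cycle. The assumption \<open>bounded\<close>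
  stops the growth of a vertex set before it has M elements; \<open>sparse\<close> then makes the
  part of the cycle inside it a boundary.\<close>

lemma acyclic_if_locally_sparse:
  fixes V :: "'a::linorder set"
  assumes dk: "1 \<le> d" "d \<le> k" and V: "finite V" and M: "k + 1 \<le> M"
    and sparse: "\<And>T. T \<subseteq> V \<Longrightarrow> T \<noteq> {} \<Longrightarrow> card T \<le> M \<Longrightarrow> dface_count d X T < (k - d + 1) * card T"
    and bounded: "\<And>T. T \<subseteq> V \<Longrightarrow> card T = M \<Longrightarrow> dface_count d X T < (k - d + 1) * (M - (k + 1))"
  shows "acyclic_at (clique_complex d V X) (Suc k)"
proof -
  let ?K = "clique_complex d V X"
  have "\<exists>c. Poly_Mapping.keys c \<subseteq> {\<sigma> \<in> ?K. card \<sigma> = Suc (Suc k)} \<and> simplicial_boundary c = z"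
    if "Poly_Mapping.keys z \<subseteq> {\<sigma> \<in> ?K. card \<sigma> = Suc k}" "simplicial_boundary z = 0" for z
    using that
  proof (induction "card (Poly_Mapping.keys z)" arbitrary: z rule: less_induct)
    case less
    show ?case
    proof (cases "z = 0")
      case True
      then show ?thesis by (intro exI[of _ 0]) simp
    next
      case False
      then obtain \<sigma>0 where \<sigma>0: "\<sigma>0 \<in> Poly_Mapping.keys z" by (metis all_not_in_conv keys_eq_empty)
      \<comment> \<open>The inequality records the gain of k - d + 1 faces for each vertex beyond
        the first k + 1; the d-faces of \<open>\<sigma>0\<close> itself are not credited, so it is
        trivial at the start.\<close>
      define P where "P T \<longleftrightarrow> T \<subseteq> V \<and> \<sigma>0 \<subseteq> T \<and> card T \<le> M \<and>
        (k - d + 1) * (card T - (k + 1)) \<le> dface_count d X T" for T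
      have "\<sigma>0 \<subseteq> V" and c0: "card \<sigma>0 = k + 1"
        using \<sigma>0 less.prems(1) by (auto simp: clique_complex_def)
      then have "P \<sigma>0" using M by (simp add: P_def)
      moreover have "\<forall>T. P T \<longrightarrow> card T < Suc M" by (simp add: P_def)
      ultimately have "\<exists>T. P T \<and> (\<forall>T'. P T' \<longrightarrow> card T' \<le> card T)"
        using arg_max_nat_lemma[of P \<sigma>0 card "Suc M"] by blast
      then obtain T where T: "P T" and max: "\<And>T'. P T' \<Longrightarrow> card T' \<le> card T" by blast
      have fT: "finite T" using T V finite_subset by (auto simp: P_def)
      have cT: "k + 1 \<le> card T" using T c0 card_mono[OF fT] by (metis P_def)
      have "card T \<noteq> M" using T bounded[of T] by (auto simp: P_def)
      then have TM: "card T < M" using T by (auto simp: P_def)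
      \<comment> \<open>A face of z with all vertices but u in T would allow u to be adjoined,
        against maximality.\<close>
      have closed: "\<tau> \<subseteq> T" if \<tau>: "\<tau> \<in> Poly_Mapping.keys z" "u \<in> \<tau>" "\<tau> - {u} \<subseteq> T" for \<tau> u
      proof (rule ccontr)
        assume "\<not> \<tau> \<subseteq> T"
        then have u: "u \<notin> T" using \<tau> by blast
        have \<tau>K: "\<tau> \<in> ?K" "card \<tau> = Suc k" using \<tau> less.prems(1) by auto
        have ins: "insert u (\<tau> - {u}) = \<tau>" using \<tau> by blast
        have "dface_count d X T + (k - d + 1) \<le> dface_count d X (insert u T)"
          by (rule dface_count_insert[of _ _ "\<tau> - {u}" _ _ V])
            (use fT u \<tau> \<tau>K dk ins clique_complex_finite[OF V \<tau>K(1)] in auto)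
        moreover have c: "card (insert u T) = Suc (card T)" using fT u by simp
        moreover have "insert u T \<subseteq> V" using T \<tau>K \<tau> by (auto simp: P_def clique_complex_def)
        moreover have "(k - d + 1) * (card (insert u T) - (k + 1))
            = (k - d + 1) * (card T - (k + 1)) + (k - d + 1)"
        proof -
          have "card (insert u T) - (k + 1) = Suc (card T - (k + 1))" using c cT by simp
          then show ?thesis by (simp only: mult_Suc_right add.commute)
        qed
        ultimately have "P (insert u T)" using T TM by (auto simp: P_def)
        then show False using max[of "insert u T"] c by simp
      qed
      obtain a b where ab: "Poly_Mapping.keys a \<subseteq> {\<sigma> \<in> Poly_Mapping.keys z. \<sigma> \<subseteq> T}"
          "Poly_Mapping.keys b \<subseteq> {\<sigma> \<in> Poly_Mapping.keys z. \<not> \<sigma> \<subseteq> T}" "a + b = z"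
        using frag_split[of z "{\<sigma> \<in> Poly_Mapping.keys z. \<sigma> \<subseteq> T}" "{\<sigma> \<in> Poly_Mapping.keys z. \<not> \<sigma> \<subseteq> T}"] by blast
      have dab: "simplicial_boundary a = - simplicial_boundary b"
        using less.prems(2) unfolding ab(3)[symmetric] simplicial_boundary_add by (simp add: eq_neg_iff_add_eq_0)
      \<comment> \<open>By \<open>closed\<close>, a facet of a face that leaves T leaves T too. So
        the boundaries of \<open>a\<close> and \<open>b\<close> share no face and, being opposite,
        both vanish.\<close>
      have "Poly_Mapping.keys (simplicial_boundary a) \<subseteq> {\<rho>. \<rho> \<subseteq> T}"
        by (rule keys_boundary_subset) (use ab(1) in blast)
      moreover have "Poly_Mapping.keys (simplicial_boundary b) \<subseteq> {\<rho>. \<not> \<rho> \<subseteq> T}"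
        by (rule keys_boundary_subset) (use ab(2) closed in blast)
      ultimately have "Poly_Mapping.keys (simplicial_boundary a) = {}"
        unfolding dab keys_minus by blast
      then have da: "simplicial_boundary a = 0" by simp
      then have db: "simplicial_boundary b = 0" using dab by simp
      have "acyclic_at (clique_complex d T X) (Suc k)"
      proof (rule acyclic_if_sparse[OF dk fT])
        fix T' assume T': "T' \<subseteq> T" "T' \<noteq> {}"
        then show "dface_count d X T' < (k - d + 1) * card T'"
          using T TM card_mono[OF fT T'(1)] by (intro sparse) (auto simp: P_def)
      qed
      moreover have "Poly_Mapping.keys a \<subseteq> {\<sigma> \<in> clique_complex d T X. card \<sigma> = Suc k}"
        using ab(1) less.prems(1) by (auto simp: clique_complex_def)
      ultimately obtain c where c: "Poly_Mapping.keys c \<subseteq> {\<sigma> \<in> clique_complex d T X. card \<sigma> = Suc (Suc k)}"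
          "simplicial_boundary c = a"
        using da unfolding acyclic_at_def by blast
      have "T \<subseteq> V" using T by (simp add: P_def)
      then have cK: "Poly_Mapping.keys c \<subseteq> {\<sigma> \<in> ?K. card \<sigma> = Suc (Suc k)}"
        using c(1) by (auto simp: clique_complex_def)
      \<comment> \<open>The face \<open>\<sigma>0\<close> lies in T and hence not in
        \<open>b\<close>, so the induction hypothesis applies to \<open>b\<close>.\<close>
      have "Poly_Mapping.keys b \<subset> Poly_Mapping.keys z" using ab(2) \<sigma>0 T unfolding P_def by blast
      then have "card (Poly_Mapping.keys b) < card (Poly_Mapping.keys z)"
        by (intro psubset_card_mono) simp_all
      moreover have "Poly_Mapping.keys b \<subseteq> {\<sigma> \<in> ?K. card \<sigma> = Suc k}" using ab(2) less.prems(1) by blast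
      ultimately obtain e where e: "Poly_Mapping.keys e \<subseteq> {\<sigma> \<in> ?K. card \<sigma> = Suc (Suc k)}"
          "simplicial_boundary e = b"
        using less.hyps[OF _ _ db] by blast
      have "Poly_Mapping.keys (c + e) \<subseteq> {\<sigma> \<in> ?K. card \<sigma> = Suc (Suc k)}"
        by (rule order_trans[OF keys_add Un_least[OF cK e(1)]])
      moreover have "simplicial_boundary (c + e) = z"
        using c e ab by (simp add: simplicial_boundary_add)
      ultimately show ?thesis by blast
    qed
  qed
  then show ?thesis unfolding acyclic_at_def by blast
qed

section \<open>The random complex\<close>

text \<open>Cycles and boundaries coincide, so the only coset is the cycle group itself. Faces of
  dimension k have k + 1 vertices, whence \<open>Suc k\<close>.\<close>

lemma trivial_homology_if_acyclic_at:
  assumes X: "abstract_simplicial_complex V X" and ac: "acyclic_at X (Suc k)"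
  shows "trivial_group (reduced_simplicial_homology X (int k))"
proof -
  let ?Z = "simplicial_cycles X (int k)" and ?B = "simplicial_boundaries X (int k)"
  let ?G = "(simplicial_chain_group X (int k))\<lparr>carrier := ?Z\<rparr>"
  have Z: "z \<in> ?Z \<longleftrightarrow> Poly_Mapping.keys z \<subseteq> {\<sigma> \<in> X. card \<sigma> = Suc k} \<and> simplicial_boundary z = 0" for z
  proof -
    \<comment> \<open>A set of positive \<open>card\<close> is finite.\<close>
    have "{\<sigma> \<in> X. finite \<sigma> \<and> int (card \<sigma>) = int k + 1} = {\<sigma> \<in> X. card \<sigma> = Suc k}"
      by (auto intro: card_ge_0_finite)
    then show ?thesis by (simp add: simplicial_cycles_def kernel_def simplicial_chain_group_def)
  qed
  have C: "c \<in> carrier (simplicial_chain_group X (int k + 1))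
      \<longleftrightarrow> Poly_Mapping.keys c \<subseteq> {\<sigma> \<in> X. card \<sigma> = Suc (Suc k)}" for c
  proof -
    have "{\<sigma> \<in> X. finite \<sigma> \<and> int (card \<sigma>) = int k + 1 + 1} = {\<sigma> \<in> X. card \<sigma> = Suc (Suc k)}"
      by (auto intro: card_ge_0_finite)
    then show ?thesis by (simp add: simplicial_chain_group_def)
  qed
  have BZ: "?B = ?Z"
  proof (intro equalityI subsetI)
    fix z assume "z \<in> ?Z"
    then obtain c where "Poly_Mapping.keys c \<subseteq> {\<sigma> \<in> X. card \<sigma> = Suc (Suc k)}" "simplicial_boundary c = z"
      using ac unfolding acyclic_at_def Z by blast
    then show "z \<in> ?B" unfolding simplicial_boundaries_def using C by blast
  next
    fix z assume "z \<in> ?B"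
    then obtain c where c: "c \<in> carrier (simplicial_chain_group X (int k + 1))" "z = simplicial_boundary c"
      unfolding simplicial_boundaries_def by blast
    then show "z \<in> ?Z"
      using simplicial_boundary_in_chain_group[OF X c(1)] simplicial_boundary_boundary[OF c(1)]
      by (simp add: simplicial_cycles_def kernel_def simplicial_chain_group_def)
  qed
  have add: "a + b \<in> ?Z" if "a \<in> ?Z" "b \<in> ?Z" for a b
    using that keys_add[of a b] unfolding Z by (auto simp: simplicial_boundary_add)
  have diff: "a - b \<in> ?Z" if "a \<in> ?Z" "b \<in> ?Z" for a b
    using that keys_diff[of a b] unfolding Z by (auto simp: boundary_diff)
  have coset: "?Z #>\<^bsub>?G\<^esub> a = ?Z" if a: "a \<in> ?Z" for a
  proof -
    have "?Z #>\<^bsub>?G\<^esub> a = (\<lambda>h. h + a) ` ?Z"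
      by (auto simp: r_coset_def simplicial_chain_group_def)
    also have "\<dots> = ?Z"
    proof (intro equalityI subsetI)
      fix x assume "x \<in> ?Z"
      then show "x \<in> (\<lambda>h. h + a) ` ?Z" using diff[OF _ a] by (intro image_eqI[of _ _ "x - a"]) auto
    qed (use add a in auto)
    finally show ?thesis .
  qed
  have "carrier (reduced_simplicial_homology X (int k)) \<subseteq> {?Z}"
  proof -
    have "carrier (reduced_simplicial_homology X (int k)) = (\<Union>a\<in>?Z. {?Z #>\<^bsub>?G\<^esub> a})"
      unfolding reduced_simplicial_homology_def FactGroup_def RCOSETS_def BZ by simp
    then show ?thesis using coset by simp
  qed
  then show ?thesis
    using group.trivial_group_alt[OF group_reduced_simplicial_homology[OF X]] by blast
qed

section \<open>First moment estimates for dense vertex sets\<close>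

lemma prob_all_faces_present:
  assumes A: "finite A" "E \<subseteq> A" and p: "0 \<le> p" "p \<le> 1"
  shows "measure_pmf.prob (Pi_pmf A False (\<lambda>_. bernoulli_pmf p)) {\<omega>. \<forall>\<sigma>\<in>E. \<omega> \<sigma>} = p ^ card E"
proof -
  have T: "measure_pmf.prob (bernoulli_pmf p) {True} = p" using p by (simp add: measure_pmf_single)
  \<comment> \<open>The event is a box: E lies in A, so only independent coordinates are
    constrained, none of those fixed to \<open>False\<close>.\<close>
  have "{\<omega>. \<forall>\<sigma>\<in>E. \<omega> \<sigma>} = Pi A (\<lambda>\<sigma>. if \<sigma> \<in> E then {True} else UNIV)"
    using A(2) by (auto simp: Pi_def)
  then have "measure_pmf.prob (Pi_pmf A False (\<lambda>_. bernoulli_pmf p)) {\<omega>. \<forall>\<sigma>\<in>E. \<omega> \<sigma>}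
      = (\<Prod>\<sigma>\<in>A. measure_pmf.prob (bernoulli_pmf p) (if \<sigma> \<in> E then {True} else UNIV))"
    using measure_Pi_pmf_Pi[OF A(1)] by simp
  also have "\<dots> = (\<Prod>\<sigma>\<in>A. if \<sigma> \<in> E then p else 1)"
    by (rule prod.cong) (simp_all add: T)
  also have "\<dots> = (\<Prod>\<sigma>\<in>E. p)"
    using A by (simp add: prod.If_cases Int_absorb1)
  finally show ?thesis by simp
qed

text \<open>The two bounds form a pair so that a finite set of pairs can index a union of such
  events.\<close>

definition dense_event :: "nat \<Rightarrow> nat \<Rightarrow> nat \<times> nat \<Rightarrow> nat set set set" where
  "dense_event d n = (\<lambda>(s, e). {X. \<exists>T\<subseteq>{1..n}. card T = s \<and> e \<le> dface_count d X T})"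

text \<open>Union bound over at most n^s vertex sets T and, for each, over the sets E of e potential
  d-faces in T. Since E is a family of subsets of T, there are at most \<open>2 ^ 2 ^ s\<close>
  choices, a constant in n.\<close>

lemma prob_dense_event_le:
  assumes p: "0 \<le> p" "p \<le> 1"
  shows "measure_pmf.prob (random_complex d n p) (dense_event d n (s, e)) \<le> 2 ^ 2 ^ s * (real n ^ s * p ^ e)"
proof -
  let ?A = "{\<sigma>. \<sigma> \<subseteq> {1..n} \<and> card \<sigma> = d + 1}"
  let ?P = "Pi_pmf ?A False (\<lambda>_. bernoulli_pmf p)"
  let ?f = "\<lambda>\<omega>. {\<sigma>. \<sigma> \<subseteq> {1..n} \<and> card \<sigma> \<le> d} \<union> {\<sigma>. \<sigma> \<subseteq> {1..n} \<and> card \<sigma> = d + 1 \<and> \<omega> \<sigma>}"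
  let ?T = "{T. T \<subseteq> {1..n} \<and> card T = s}"
  let ?E = "\<lambda>T. {E. E \<subseteq> {\<sigma> \<in> ?A. \<sigma> \<subseteq> T} \<and> card E = e}"
  let ?W = "\<lambda>E. {\<omega>. \<forall>\<sigma>\<in>E. \<omega> \<sigma>}"
  have finA: "finite ?A" by (rule finite_subset[of _ "Pow {1..n}"]) auto
  have finT: "finite ?T" by (rule finite_subset[of _ "Pow {1..n}"]) auto
  have finE: "finite (?E T)" for T by (rule finite_subset[of _ "Pow ?A"]) (use finA in auto)
  have "?f -` dense_event d n (s, e) \<subseteq> (\<Union>T\<in>?T. \<Union>E\<in>?E T. ?W E)"
  proof
    fix \<omega> assume "\<omega> \<in> ?f -` dense_event d n (s, e)"
    then obtain T where T: "T \<in> ?T" "e \<le> dface_count d (?f \<omega>) T"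
      unfolding dense_event_def by auto
    have eq: "{\<sigma> \<in> ?f \<omega>. \<sigma> \<subseteq> T \<and> card \<sigma> = d + 1} = {\<sigma> \<in> ?A. \<sigma> \<subseteq> T \<and> \<omega> \<sigma>}" by auto
    have "e \<le> card {\<sigma> \<in> ?A. \<sigma> \<subseteq> T \<and> \<omega> \<sigma>}" using T(2) unfolding dface_count_def eq .
    then obtain E where E: "E \<subseteq> {\<sigma> \<in> ?A. \<sigma> \<subseteq> T \<and> \<omega> \<sigma>}" "card E = e"
      by (rule obtain_subset_with_card_n)
    then have "E \<in> ?E T" "\<omega> \<in> ?W E" by auto
    then show "\<omega> \<in> (\<Union>T\<in>?T. \<Union>E\<in>?E T. ?W E)" using T(1) by blast
  qed
  then have "measure_pmf.prob (random_complex d n p) (dense_event d n (s, e))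
      \<le> measure_pmf.prob ?P (\<Union>T\<in>?T. \<Union>E\<in>?E T. ?W E)"
    unfolding random_complex_def measure_map_pmf by (intro measure_pmf.finite_measure_mono) auto
  also have "\<dots> \<le> (\<Sum>T\<in>?T. measure_pmf.prob ?P (\<Union>E\<in>?E T. ?W E))"
    using finT by (intro measure_pmf.finite_measure_subadditive_finite) auto
  also have "\<dots> \<le> (\<Sum>T\<in>?T. 2 ^ 2 ^ s * p ^ e)"
  proof (rule sum_mono)
    fix T assume T: "T \<in> ?T"
    then have fT: "finite T" using finite_subset by blast
    have "measure_pmf.prob ?P (\<Union>E\<in>?E T. ?W E) \<le> (\<Sum>E\<in>?E T. measure_pmf.prob ?P (?W E))"
      using finE by (intro measure_pmf.finite_measure_subadditive_finite) auto
    also have "\<dots> = (\<Sum>E\<in>?E T. p ^ e)"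
    proof (rule sum.cong[OF refl])
      fix E assume "E \<in> ?E T"
      then show "measure_pmf.prob ?P (?W E) = p ^ e"
        using prob_all_faces_present[OF finA _ p, of E] by auto
    qed
    also have "\<dots> = real (card (?E T)) * p ^ e" by simp
    also have "\<dots> \<le> 2 ^ 2 ^ s * p ^ e"
    proof (rule mult_right_mono)
      have "card (?E T) \<le> card (Pow (Pow T))" using fT by (intro card_mono) auto
      then have "card (?E T) \<le> 2 ^ 2 ^ s" using T fT by (simp add: card_Pow)
      then have "real (card (?E T)) \<le> real (2 ^ 2 ^ s)" by (simp only: of_nat_le_iff)
      then show "real (card (?E T)) \<le> 2 ^ 2 ^ s" by simp
    qed (use p in simp)
    finally show "measure_pmf.prob ?P (\<Union>E\<in>?E T. ?W E) \<le> 2 ^ 2 ^ s * p ^ e" .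
  qed
  also have "\<dots> = real (n choose s) * (2 ^ 2 ^ s * p ^ e)" by (simp add: n_subsets)
  also have "\<dots> \<le> real n ^ s * (2 ^ 2 ^ s * p ^ e)"
  proof (rule mult_right_mono)
    show "real (n choose s) \<le> real n ^ s"
    proof (cases "s \<le> n")
      case True
      then have "real (n choose s) \<le> real (n ^ s)" by (simp only: of_nat_le_iff binomial_le_pow)
      then show ?thesis by simp
    qed (simp add: binomial_eq_0)
  qed (use p in simp)
  finally show ?thesis by (simp add: mult_ac)
qed

lemma prob_dense_event_tendsto_0:
  assumes "\<alpha> < 0" "real s + \<alpha> * real e < 0"
  shows "(\<lambda>n. measure_pmf.prob (random_complex d n (real n powr \<alpha>)) (dense_event d n (s, e))) \<longlonglongrightarrow> 0"
proof (rule tendsto_sandwich[of "\<lambda>_. 0"])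
  show "\<forall>\<^sub>F n in sequentially. measure_pmf.prob (random_complex d n (real n powr \<alpha>)) (dense_event d n (s, e))
      \<le> 2 ^ 2 ^ s * (real n powr (real s + \<alpha> * real e))"
  proof (rule eventually_sequentiallyI[of 1])
    fix n :: nat assume n: "1 \<le> n"
    have "real n powr \<alpha> \<le> real n powr 0" using n assms by (intro powr_mono) auto
    then have "real n powr \<alpha> \<le> 1" using n by simp
    moreover have "real n ^ s * (real n powr \<alpha>) ^ e = real n powr (real s + \<alpha> * real e)"
      using n by (simp add: powr_add powr_powr powr_realpow[symmetric])
    ultimately show "measure_pmf.prob (random_complex d n (real n powr \<alpha>)) (dense_event d n (s, e))
        \<le> 2 ^ 2 ^ s * (real n powr (real s + \<alpha> * real e))"
      using prob_dense_event_le[of "real n powr \<alpha>" d n s e] by simp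
  qed
  have "(\<lambda>n. real n powr (real s + \<alpha> * real e)) \<longlonglongrightarrow> 0"
    using assms(2) by (intro tendsto_neg_powr filterlim_real_sequentially)
  then show "(\<lambda>n. 2 ^ 2 ^ s * (real n powr (real s + \<alpha> * real e))) \<longlonglongrightarrow> 0"
    by (rule tendsto_mult_right_zero)
qed auto

theorem theorem3p7:
  fixes d k :: nat and \<alpha> :: real
  assumes "1 \<le> d" and "d \<le> k"
    and "\<alpha> < - 1 / (real k - real d + 1)"
  shows "(\<lambda>n. measure_pmf.prob (random_complex d n (real n powr \<alpha>))
            {X. trivial_group (reduced_simplicial_homology (clique_complex d {1..n} X) (int k))})
         \<longlonglongrightarrow> 1"
proof -
  define j where "j = k - d + 1"
  have j: "real j = real k - real d + 1" "j > 0" using assms(2) by (simp_all add: j_def of_nat_diff)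
  have \<alpha>j: "\<alpha> * real j < - 1"
    using assms(3) j(2) unfolding j(1)[symmetric] by (simp add: field_simps)
  then have \<alpha>: "\<alpha> < 0" using j(2) by (smt (verit) mult_nonneg_nonneg of_nat_0_le_iff)
  \<comment> \<open>This makes the exponent \<open>k + 1 + m + \<alpha> * j * m\<close> of the
    expected number of sets with m + k + 1 vertices and j m faces negative; the factor of m is
    positive since \<open>\<alpha> * j < - 1\<close>.\<close>
  obtain m :: nat where m: "real (k + 1) < real m * (- 1 - \<alpha> * real j)"
    using reals_Archimedean3[of "- 1 - \<alpha> * real j"] \<alpha>j by fastforce
  define M where "M = m + (k + 1)"
  \<comment> \<open>The first pair serves \<open>bounded\<close>, as m = M - (k + 1); the others
    serve \<open>sparse\<close>. The size s = 0 is left out, as its event would be certain.\<close>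
  define I where "I = insert (M, j * m) ((\<lambda>s. (s, j * s)) ` {1..M})"
  have I: "real s + \<alpha> * real e < 0" if "(s, e) \<in> I" for s e
  proof -
    have "real M + \<alpha> * real (j * m) < 0"
      using m by (simp add: M_def algebra_simps)
    moreover have "real s + \<alpha> * real (j * s) < 0" if "1 \<le> s" for s
    proof -
      have "real s * (1 + \<alpha> * real j) < 0" using \<alpha>j that by (intro mult_pos_neg) auto
      then show ?thesis by (simp add: algebra_simps)
    qed
    ultimately show ?thesis using that unfolding I_def by (auto simp del: of_nat_mult)
  qed
  let ?P = "\<lambda>n. measure_pmf.prob (random_complex d n (real n powr \<alpha>))"
  let ?good = "\<lambda>n. {X. trivial_group (reduced_simplicial_homology (clique_complex d {1..n} X) (int k))}"
  have finI: "finite I" by (simp add: I_def)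
  have good: "X \<in> ?good n" if X: "X \<notin> (\<Union>i\<in>I. dense_event d n i)" for X n
  proof -
    have sparse: "dface_count d X T < e" if "(card T, e) \<in> I" "T \<subseteq> {1..n}" for T e
    proof (rule ccontr)
      assume "\<not> ?thesis"
      then have "X \<in> dense_event d n (card T, e)" using that(2) by (auto simp: dense_event_def)
      then show False using X that(1) by blast
    qed
    have "acyclic_at (clique_complex d {1..n} X) (Suc k)"
    proof (rule acyclic_if_locally_sparse[OF assms(1,2) finite_atLeastAtMost, of M])
      show "k + 1 \<le> M" by (simp add: M_def)
      show "dface_count d X T < (k - d + 1) * card T"
        if T: "T \<subseteq> {1..n}" "T \<noteq> {}" "card T \<le> M" for T
      proof -
        have "card T > 0" using T finite_subset card_gt_0_iff by blast
        then have "(card T, j * card T) \<in> I" using T(3) by (auto simp: I_def)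
        then show ?thesis using sparse T(1) unfolding j_def by blast
      qed
      show "dface_count d X T < (k - d + 1) * (M - (k + 1))" if "T \<subseteq> {1..n}" "card T = M" for T
        using sparse[of T "j * m"] that by (simp add: I_def j_def M_def)
    qed
    then show ?thesis
      using trivial_homology_if_acyclic_at clique_complex_is_complex[OF assms(1) finite_atLeastAtMost] by blast
  qed
  \<comment> \<open>Outside the dense events the deterministic criterion gives trivial homology, so
    the failure probability is at most a finite sum of null sequences.\<close>
  have lower: "1 - (\<Sum>i\<in>I. ?P n (dense_event d n i)) \<le> ?P n (?good n)" for n
  proof -
    have "1 - ?P n (?good n) = ?P n (- ?good n)"
      using measure_pmf.prob_compl[of "?good n"] by (simp add: Compl_eq_Diff_UNIV)
    also have "\<dots> \<le> ?P n (\<Union>i\<in>I. dense_event d n i)"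
    proof (rule measure_pmf.finite_measure_mono)
      show "- ?good n \<subseteq> (\<Union>i\<in>I. dense_event d n i)"
      proof (rule subsetI, rule ccontr)
        fix X assume "X \<in> - ?good n" and X: "X \<notin> (\<Union>i\<in>I. dense_event d n i)"
        then have "X \<notin> ?good n" by (simp only: Compl_iff simp_thms)
        then show False using good[OF X] by (rule notE)
      qed
    qed simp
    also have "\<dots> \<le> (\<Sum>i\<in>I. ?P n (dense_event d n i))"
      using finI by (intro measure_pmf.finite_measure_subadditive_finite) auto
    finally show ?thesis by simp
  qed
  have "(\<lambda>n. \<Sum>i\<in>I. ?P n (dense_event d n i)) \<longlonglongrightarrow> (\<Sum>i\<in>I. 0)"
  proof (rule tendsto_sum)
    fix i assume "i \<in> I"
    then show "(\<lambda>n. ?P n (dense_event d n i)) \<longlonglongrightarrow> 0"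
      using prob_dense_event_tendsto_0[OF \<alpha> I] by (cases i) auto
  qed
  then have "(\<lambda>n. 1 - (\<Sum>i\<in>I. ?P n (dense_event d n i))) \<longlonglongrightarrow> 1 - (\<Sum>i\<in>I. 0)"
    by (intro tendsto_diff tendsto_const)
  then have lim: "(\<lambda>n. 1 - (\<Sum>i\<in>I. ?P n (dense_event d n i))) \<longlonglongrightarrow> 1" by simp
  show ?thesis
  proof (rule tendsto_sandwich[OF _ _ lim tendsto_const])
    show "\<forall>\<^sub>F n in sequentially. 1 - (\<Sum>i\<in>I. ?P n (dense_event d n i)) \<le> ?P n (?good n)"
      using lower by simp
    show "\<forall>\<^sub>F n in sequentially. ?P n (?good n) \<le> 1" by simp
  qed
qed

end
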